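(* Let spaces $\mathcal C_p$, $1<p<\infty$, satisfying (COREI), (COREII) and (COREIII) (as listed in the context) be given and assume $m(X)<\infty$. Then $(\partial_p,\mathcal C_p)$ is a closable operator from $L_p(X,m)$ to $L_p(X,m,(\mathcal H_x)_{x\in X})$ for any $2<p<\infty$.
   Context: $X$ is a locally compact separable metric space. A nonnegative Radon measure on $X$ is an admissible reference measure if it gives positive mass to every nonempty open set. Let $\mu$ be an admissible reference measure and $(\mathcal E,\mathcal F)$ a regular symmetric Dirichlet form on $L_2(X,\mu)$; $\mathcal E(f)=\mathcal E(f,f)$. $C_0(X)$ is the space of continuous compactly supported functions, $\mathcal C:=C_0(X)\cap\mathcal F$, $\mathcal B_b(X)$ the bounded Borel functions. Energy measures: for $g,h\in\mathcal C$, $\Gamma(g,h)$ is the unique finite signed Radon measure with $2\int_X f\,d\Gamma(g,h)=\mathcal E(fg,h)+\mathcal E(fh,g)-\mathcal E(gh,f)$ for all $f\in\mathcal C$; $\Gamma(g):=\Gamma(g,g)\ge0$. $\mathcal H$ is the Hilbert space completion of $\mathcal C\otimes\mathcal B_b(X)/\ker\|\cdot\|_{\mathcal H}$ with respect to the nonnegative definite form determined by $\langle a\otimes b,c\otimes d\rangle_{\mathcal H}:=\int_X bd\,d\Gamma(a,c)$. The differential is $\partial f:=f\otimes\mathbf 1$, $f\in\mathcal C$, and $g\partial f:=f\otimes g$. Let $m$ be an admissible reference measure such that $\Gamma(f)$ is absolutely continuous with respect to $m$ for every $f\in\mathcal C$; $\Gamma(f,g)$ also denotes the density. Standing assumption: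 $(\mathcal E,\mathcal C)$ is closable on $L_2(X,m)$. Fibers: let $\mathcal A_0=\{f_n\}_n\subset\mathcal C$ be countable and $\mathcal E$-dense in $\mathcal C$, $\mathcal A:=\mathrm{span}(\mathcal A_0)$. Choose Borel versions $x\mapsto\Gamma_x(f_i,f_j)$ of the densities such that for all $N$ and all $x$ the matrix $(\Gamma_x(f_i,f_j))_{i,j\le N}$ is symmetric nonnegative definite, and extend bilinearly to $\mathcal A$ (versions chosen so that this is well defined). $\mathcal H_x$ is the Hilbert space completion of $\mathcal A\otimes\mathcal B_b(X)/\ker\Gamma_{\mathcal H,x}$ with respect to $\Gamma_{\mathcal H,x}(a\otimes b,c\otimes d):=b(x)d(x)\Gamma_x(a,c)$; $[a\otimes b]_x$ denotes classes. Measurable sections are those $\xi\in\prod_x\mathcal H_x$ with $x\mapsto\langle\xi(x),[f_n\otimes\mathbf 1]_x\rangle_{\mathcal H_x}$ measurable for all $n$. $\mathcal H$ is identified with the direct integral $\int_X^\oplus\mathcal H_x\,m(dx)$ via the isometric isomorphism determined by $a\otimes b\mapsto(x\mapsto[a\otimes b]_x)$, $a\otimes b\in\mathcal A\otimes\mathcal B_b(X)$. For $1\le p<\infty$, $L_p(X,m,(\mathcal H_x)_{x\in X})$ is the Banach space of $m$-classes of measurable sections $v$ with $\|v\|^p=\int_X\|v_x\|_{\mathcal H_x}^p\,m(dx)<\infty$; so $\mathcal H=L_2(X,m,(\mathcal H_x)_{x\in X})$. Assumption on cores: for any $1<p<\infty$ there is a space $\mathcal C_p\subset\mathcal C\cap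 L_p(X,m)$ such that (COREI) $\mathcal C_p$ is dense in $L_p(X,m)$; (COREII) $\mathcal C_p\otimes\mathcal C_p$ (the span of the $g\partial f=f\otimes g$, $f,g\in\mathcal C_p$) is dense in $L_p(X,m,(\mathcal H_x)_{x\in X})$; (COREIII) for all $f\in\mathcal C_p$, $\Gamma(f)$ is absolutely continuous with respect to $m$ with density $\frac{d\Gamma(f)}{dm}\in L_{p/2}(X,m)$. $\partial_p$ denotes the restriction of $\partial$ to $\mathcal C_p$; by (COREIII) it maps $\mathcal C_p$ into $L_p(X,m,(\mathcal H_x)_{x\in X})$. *)

theory Defs
  imports "HOL-Analysis.Analysis"
begin

text \<open>
  The space \<open>X\<close> is a type \<open>'a :: {metric_space, second_countable_topology}\<close> (for a metric space, second
  countable means separable) whose universe is assumed locally compact. Real functions on \<open>X\<close> are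
  plain functions \<open>'a \<Rightarrow> real\<close> with the pointwise vector space operations; elements of
  \<open>L\<^sub>p\<close>-spaces are represented by Borel functions (or sections), identified almost everywhere.
\<close>

definition radon_measure :: "'a::topological_space measure \<Rightarrow> bool" where
  "radon_measure M \<longleftrightarrow>
     sets M = sets borel \<and>
     (\<forall>K. compact K \<longrightarrow> emeasure M K < \<infinity>) \<and>
     (\<forall>B\<in>sets borel. emeasure M B = (SUP K\<in>{K. compact K \<and> K \<subseteq> B}. emeasure M K))"

definition admissible_measure :: "'a::topological_space measure \<Rightarrow> bool" where
  "admissible_measure M \<longleftrightarrow>
     radon_measure M \<and> (\<forall>U. open U \<and> U \<noteq> {} \<longrightarrow> emeasure M U > 0)"

text \<open>A finite signed measure is given by its values on Borel sets; it is a difference of finite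
  nonnegative ones (e.g. its Jordan decomposition).\<close>

definition signed_decomposition ::
  "('a::topological_space set \<Rightarrow> real) \<Rightarrow> 'a measure \<Rightarrow> 'a measure \<Rightarrow> bool" where
  "signed_decomposition \<nu> M N \<longleftrightarrow>
     radon_measure M \<and> finite_measure M \<and> radon_measure N \<and> finite_measure N \<and>
     (\<forall>B\<in>sets borel. \<nu> B = measure M B - measure N B)"

definition finite_signed_radon :: "('a::topological_space set \<Rightarrow> real) \<Rightarrow> bool" where
  "finite_signed_radon \<nu> \<longleftrightarrow> (\<exists>M N. signed_decomposition \<nu> M N)"

text \<open>For bounded Borel integrands, the only ones used below, the value does not depend on the
  decomposition that is chosen.\<close>

definition signed_integral :: "('a::topological_space set \<Rightarrow> real) \<Rightarrow> ('a \<Rightarrow> real) \<Rightarrow> real" where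
  "signed_integral \<nu> f =
     (let MN = (SOME MN. signed_decomposition \<nu> (fst MN) (snd MN))
      in (LINT x|fst MN. f x) - (LINT x|snd MN. f x))"

definition signed_abs_cont :: "'a measure \<Rightarrow> ('a set \<Rightarrow> real) \<Rightarrow> bool" where
  "signed_abs_cont m \<nu> \<longleftrightarrow> (\<forall>B\<in>null_sets m. \<nu> B = 0)"

definition is_density :: "'a measure \<Rightarrow> ('a set \<Rightarrow> real) \<Rightarrow> ('a \<Rightarrow> real) \<Rightarrow> bool" where
  "is_density m \<nu> \<rho> \<longleftrightarrow>
     integrable m \<rho> \<and> (\<forall>B\<in>sets m. \<nu> B = (LINT x:B|m. \<rho> x))"

definition fun_subspace :: "('a \<Rightarrow> real) set \<Rightarrow> bool" where
  "fun_subspace V \<longleftrightarrow>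
     (\<lambda>x. 0) \<in> V \<and>
     (\<forall>f\<in>V. \<forall>g\<in>V. (\<lambda>x. f x + g x) \<in> V) \<and>
     (\<forall>c. \<forall>f\<in>V. (\<lambda>x. c * f x) \<in> V)"

definition seq_span :: "(nat \<Rightarrow> 'a \<Rightarrow> real) \<Rightarrow> ('a \<Rightarrow> real) set" where
  "seq_span \<phi> = {a. \<exists>N c. a = (\<lambda>x. \<Sum>i<N. c i * \<phi> i x)}"

definition C0_fun :: "('a::topological_space \<Rightarrow> real) set" where
  "C0_fun = {f. continuous_on UNIV f \<and> compact (closure {x. f x \<noteq> 0})}"

definition bounded_borel :: "('a::topological_space \<Rightarrow> real) set" where
  "bounded_borel = {b. b \<in> borel_measurable borel \<and> bounded (range b)}"

text \<open>The \<open>p\<close>-th power of the \<open>L\<^sub>p\<close>-norm, for scalar functions as well as for sections. Being a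
  nonnegative integral it is infinite outside of \<open>L\<^sub>p\<close>, so smallness of it entails integrability.\<close>

definition Lp_pow :: "'a measure \<Rightarrow> real \<Rightarrow> ('a \<Rightarrow> 'b::real_normed_vector) \<Rightarrow> ennreal" where
  "Lp_pow m p g = (\<integral>\<^sup>+x. ennreal (norm (g x) powr p) \<partial>m)"

definition Lp_fun :: "'a measure \<Rightarrow> real \<Rightarrow> ('a \<Rightarrow> real) set" where
  "Lp_fun m p = {f. f \<in> borel_measurable m \<and> Lp_pow m p f < \<infinity>}"

definition E1 :: "'a measure \<Rightarrow> (('a \<Rightarrow> real) \<Rightarrow> ('a \<Rightarrow> real) \<Rightarrow> real) \<Rightarrow> ('a \<Rightarrow> real) \<Rightarrow> real" where
  "E1 \<mu> E f = E f f + (LINT x|\<mu>. (f x)\<^sup>2)"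

text \<open>The domain \<open>F\<close> is a set of functions saturated under almost everywhere equality, on which
  \<open>E\<close> respects that equality; this is the same as a form on a subspace of \<open>L\<^sub>2\<close>-classes.\<close>

definition symmetric_dirichlet_form ::
  "'a measure \<Rightarrow> ('a \<Rightarrow> real) set \<Rightarrow> (('a \<Rightarrow> real) \<Rightarrow> ('a \<Rightarrow> real) \<Rightarrow> real) \<Rightarrow> bool" where
  "symmetric_dirichlet_form \<mu> F E \<longleftrightarrow>
     F \<subseteq> Lp_fun \<mu> 2 \<and> fun_subspace F \<and>
     (\<forall>f\<in>F. \<forall>g\<in>borel_measurable \<mu>. (AE x in \<mu>. f x = g x) \<longrightarrow>
        g \<in> F \<and> (\<forall>h\<in>F. E g h = E f h)) \<and>
     (\<forall>f\<in>Lp_fun \<mu> 2. \<forall>e>0. \<exists>g\<in>F. Lp_pow \<mu> 2 (\<lambda>x. f x - g x) < e) \<and>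
     (\<forall>f\<in>F. \<forall>g\<in>F. E f g = E g f) \<and>
     (\<forall>f\<in>F. \<forall>g\<in>F. \<forall>h\<in>F. E (\<lambda>x. f x + g x) h = E f h + E g h) \<and>
     (\<forall>c. \<forall>f\<in>F. \<forall>h\<in>F. E (\<lambda>x. c * f x) h = c * E f h) \<and>
     (\<forall>f\<in>F. 0 \<le> E f f) \<and>
     (\<forall>u. (\<forall>n. u n \<in> F) \<and>
        (\<forall>e>0. \<exists>N. \<forall>i\<ge>N. \<forall>j\<ge>N. E1 \<mu> E (\<lambda>x. u i x - u j x) < e) \<longrightarrow>
        (\<exists>f\<in>F. (\<lambda>n. E1 \<mu> E (\<lambda>x. u n x - f x)) \<longlonglongrightarrow> 0)) \<and>
     (\<forall>f\<in>F. (\<lambda>x. min (max (f x) 0) 1) \<in> F \<and>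
        E (\<lambda>x. min (max (f x) 0) 1) (\<lambda>x. min (max (f x) 0) 1) \<le> E f f)"

definition form_core :: "('a::topological_space \<Rightarrow> real) set \<Rightarrow> ('a \<Rightarrow> real) set" where
  "form_core F = C0_fun \<inter> F"

definition regular_form :: "'a::topological_space measure \<Rightarrow> ('a \<Rightarrow> real) set \<Rightarrow>
    (('a \<Rightarrow> real) \<Rightarrow> ('a \<Rightarrow> real) \<Rightarrow> real) \<Rightarrow> bool" where
  "regular_form \<mu> F E \<longleftrightarrow>
     (\<forall>f\<in>F. \<forall>e>0. \<exists>g\<in>form_core F. E1 \<mu> E (\<lambda>x. f x - g x) < e) \<and>
     (\<forall>f\<in>C0_fun. \<forall>e>0. \<exists>g\<in>form_core F. \<forall>x. \<bar>f x - g x\<bar> < e)"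

text \<open>\<open>\<Gamma>\<close> is the family of mutual energy measures of \<open>(E, F)\<close>; for a regular Dirichlet form the
  conditions determine the values of \<open>\<Gamma> g h\<close> on Borel sets uniquely.\<close>

definition energy_measures :: "('a::topological_space \<Rightarrow> real) set \<Rightarrow>
    (('a \<Rightarrow> real) \<Rightarrow> ('a \<Rightarrow> real) \<Rightarrow> real) \<Rightarrow>
    (('a \<Rightarrow> real) \<Rightarrow> ('a \<Rightarrow> real) \<Rightarrow> 'a set \<Rightarrow> real) \<Rightarrow> bool" where
  "energy_measures F E \<Gamma> \<longleftrightarrow>
     (\<forall>g\<in>form_core F. \<forall>h\<in>form_core F.
        finite_signed_radon (\<Gamma> g h) \<and>
        (\<forall>f\<in>form_core F.
           2 * signed_integral (\<Gamma> g h) f =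
             E (\<lambda>x. f x * g x) h + E (\<lambda>x. f x * h x) g - E (\<lambda>x. g x * h x) f)) \<and>
     (\<forall>g\<in>form_core F. \<forall>B\<in>sets borel. 0 \<le> \<Gamma> g g B)"

definition closable_form_on_L2 :: "'a measure \<Rightarrow> ('a \<Rightarrow> real) set \<Rightarrow>
    (('a \<Rightarrow> real) \<Rightarrow> ('a \<Rightarrow> real) \<Rightarrow> real) \<Rightarrow> bool" where
  "closable_form_on_L2 m D E \<longleftrightarrow>
     (\<forall>u. (\<forall>n. u n \<in> D) \<and> (\<lambda>n. Lp_pow m 2 (u n)) \<longlonglongrightarrow> 0 \<and>
        (\<forall>e>0. \<exists>N. \<forall>i\<ge>N. \<forall>j\<ge>N.
           E (\<lambda>x. u i x - u j x) (\<lambda>x. u i x - u j x) < e) \<longrightarrow>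
        (\<lambda>n. E (u n) (u n)) \<longlonglongrightarrow> 0)"

text \<open>
  \<open>(H, \<tau>)\<close> is a Hilbert space completion of \<open>V \<otimes> W\<close> modulo the kernel of the form
  determined by \<open>\<langle>a \<otimes> b, c \<otimes> d\<rangle> = q a b c d\<close>: a complete space with a linear map from \<open>V \<otimes> W\<close>, given
  as a bilinear map \<open>\<tau>\<close> on \<open>V \<times> W\<close>, that preserves the form and has dense range. The completion is
  unique up to isometric isomorphism; it is realized as a closed subspace of an ambient Hilbert
  space so that the fibers over all points can share one type (their Hilbert sum, say).
\<close>

definition tensor_completion :: "('a \<Rightarrow> real) set \<Rightarrow> ('a \<Rightarrow> real) set \<Rightarrow>
    (('a \<Rightarrow> real) \<Rightarrow> ('a \<Rightarrow> real) \<Rightarrow> ('a \<Rightarrow> real) \<Rightarrow> ('a \<Rightarrow> real) \<Rightarrow> real) \<Rightarrow>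
    (('a \<Rightarrow> real) \<Rightarrow> ('a \<Rightarrow> real) \<Rightarrow> 'h::{real_inner, complete_space}) \<Rightarrow> 'h set \<Rightarrow> bool" where
  "tensor_completion V W q \<tau> H \<longleftrightarrow>
     (\<forall>a\<in>V. \<forall>c\<in>V. \<forall>b\<in>W. \<tau> (\<lambda>x. a x + c x) b = \<tau> a b + \<tau> c b) \<and>
     (\<forall>r. \<forall>a\<in>V. \<forall>b\<in>W. \<tau> (\<lambda>x. r * a x) b = r *\<^sub>R \<tau> a b) \<and>
     (\<forall>a\<in>V. \<forall>b\<in>W. \<forall>d\<in>W. \<tau> a (\<lambda>x. b x + d x) = \<tau> a b + \<tau> a d) \<and>
     (\<forall>r. \<forall>a\<in>V. \<forall>b\<in>W. \<tau> a (\<lambda>x. r * b x) = r *\<^sub>R \<tau> a b) \<and>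
     (\<forall>a\<in>V. \<forall>b\<in>W. \<forall>c\<in>V. \<forall>d\<in>W. \<tau> a b \<bullet> \<tau> c d = q a b c d) \<and>
     H = closure (span {\<tau> a b | a b. a \<in> V \<and> b \<in> W})"

definition energy_dense_sequence :: "('a::topological_space \<Rightarrow> real) set \<Rightarrow>
    (('a \<Rightarrow> real) \<Rightarrow> ('a \<Rightarrow> real) \<Rightarrow> real) \<Rightarrow> (nat \<Rightarrow> 'a \<Rightarrow> real) \<Rightarrow> bool" where
  "energy_dense_sequence F E \<phi> \<longleftrightarrow>
     range \<phi> \<subseteq> form_core F \<and>
     (\<forall>g\<in>form_core F. \<forall>e>0. \<exists>n. E (\<lambda>x. g x - \<phi> n x) (\<lambda>x. g x - \<phi> n x) < e)"

text \<open>\<open>G x a c\<close> stands for \<open>\<Gamma>\<^sub>x(a, c)\<close>, \<open>a\<close> and \<open>c\<close> in the span of the sequence \<open>\<phi>\<close>. That the last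
  condition holds for all representations of \<open>a\<close> and \<open>c\<close> is the well-definedness of the bilinear
  extension.\<close>

definition fiber_forms :: "'a::topological_space measure \<Rightarrow>
    (('a \<Rightarrow> real) \<Rightarrow> ('a \<Rightarrow> real) \<Rightarrow> 'a set \<Rightarrow> real) \<Rightarrow> (nat \<Rightarrow> 'a \<Rightarrow> real) \<Rightarrow>
    ('a \<Rightarrow> ('a \<Rightarrow> real) \<Rightarrow> ('a \<Rightarrow> real) \<Rightarrow> real) \<Rightarrow> bool" where
  "fiber_forms m \<Gamma> \<phi> G \<longleftrightarrow>
     (\<forall>i j. (\<lambda>x. G x (\<phi> i) (\<phi> j)) \<in> borel_measurable borel \<and>
        is_density m (\<Gamma> (\<phi> i) (\<phi> j)) (\<lambda>x. G x (\<phi> i) (\<phi> j))) \<and>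
     (\<forall>x i j. G x (\<phi> i) (\<phi> j) = G x (\<phi> j) (\<phi> i)) \<and>
     (\<forall>x N c. 0 \<le> (\<Sum>i\<le>N. \<Sum>j\<le>N. c i * c j * G x (\<phi> i) (\<phi> j))) \<and>
     (\<forall>x M N c d. G x (\<lambda>y. \<Sum>i<M. c i * \<phi> i y) (\<lambda>y. \<Sum>j<N. d j * \<phi> j y) =
        (\<Sum>i<M. \<Sum>j<N. c i * d j * G x (\<phi> i) (\<phi> j)))"

text \<open>\<open>cls x a b\<close> is the class of \<open>a \<otimes> b\<close> in the fiber \<open>Hx x\<close>.\<close>

definition measurable_sections :: "(nat \<Rightarrow> 'a::topological_space \<Rightarrow> real) \<Rightarrow> ('a \<Rightarrow> 'v set) \<Rightarrow>
    ('a \<Rightarrow> ('a \<Rightarrow> real) \<Rightarrow> ('a \<Rightarrow> real) \<Rightarrow> 'v::real_inner) \<Rightarrow> ('a \<Rightarrow> 'v) set" where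
  "measurable_sections \<phi> Hx cls =
     {\<xi>. (\<forall>x. \<xi> x \<in> Hx x) \<and>
         (\<forall>n. (\<lambda>x. \<xi> x \<bullet> cls x (\<phi> n) (\<lambda>y. 1)) \<in> borel_measurable borel)}"

definition Lp_sections :: "'a::topological_space measure \<Rightarrow> real \<Rightarrow> (nat \<Rightarrow> 'a \<Rightarrow> real) \<Rightarrow>
    ('a \<Rightarrow> 'v set) \<Rightarrow> ('a \<Rightarrow> ('a \<Rightarrow> real) \<Rightarrow> ('a \<Rightarrow> real) \<Rightarrow> 'v::real_inner) \<Rightarrow> ('a \<Rightarrow> 'v) set" where
  "Lp_sections m p \<phi> Hx cls = {\<xi> \<in> measurable_sections \<phi> Hx cls. Lp_pow m p \<xi> < \<infinity>}"

text \<open>\<open>\<Phi>\<close> is the isometric isomorphism from \<open>H\<close> onto the direct integral of the fibers determined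
  by mapping \<open>a \<otimes> b\<close> to the section of the classes of \<open>a \<otimes> b\<close>, with values represented by
  sections.\<close>

definition direct_integral_iso :: "'a::topological_space measure \<Rightarrow> (nat \<Rightarrow> 'a \<Rightarrow> real) \<Rightarrow>
    ('a \<Rightarrow> 'v set) \<Rightarrow> ('a \<Rightarrow> ('a \<Rightarrow> real) \<Rightarrow> ('a \<Rightarrow> real) \<Rightarrow> 'v::real_inner) \<Rightarrow> 'h set \<Rightarrow>
    (('a \<Rightarrow> real) \<Rightarrow> ('a \<Rightarrow> real) \<Rightarrow> 'h::real_inner) \<Rightarrow> ('h \<Rightarrow> 'a \<Rightarrow> 'v) \<Rightarrow> bool" where
  "direct_integral_iso m \<phi> Hx cls H \<tau> \<Phi> \<longleftrightarrow>
     (\<forall>h\<in>H. \<Phi> h \<in> Lp_sections m 2 \<phi> Hx cls) \<and>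
     (\<forall>h\<in>H. \<forall>k\<in>H. AE x in m. \<Phi> (h + k) x = \<Phi> h x + \<Phi> k x) \<and>
     (\<forall>c. \<forall>h\<in>H. AE x in m. \<Phi> (c *\<^sub>R h) x = c *\<^sub>R \<Phi> h x) \<and>
     (\<forall>h\<in>H. Lp_pow m 2 (\<Phi> h) = ennreal ((norm h)\<^sup>2)) \<and>
     (\<forall>\<xi>\<in>Lp_sections m 2 \<phi> Hx cls. \<exists>h\<in>H. AE x in m. \<Phi> h x = \<xi> x) \<and>
     (\<forall>a\<in>seq_span \<phi>. \<forall>b\<in>bounded_borel. AE x in m. \<Phi> (\<tau> a b) x = cls x a b)"

definition differential ::
  "(('a \<Rightarrow> real) \<Rightarrow> ('a \<Rightarrow> real) \<Rightarrow> 'h) \<Rightarrow> ('a \<Rightarrow> real) \<Rightarrow> 'h" where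
  "differential \<tau> f = \<tau> f (\<lambda>x. 1)"

definition core_I :: "'a measure \<Rightarrow> real \<Rightarrow> ('a \<Rightarrow> real) set \<Rightarrow> bool" where
  "core_I m p D \<longleftrightarrow> (\<forall>f\<in>Lp_fun m p. \<forall>e>0. \<exists>g\<in>D. Lp_pow m p (\<lambda>x. f x - g x) < e)"

definition core_II :: "'a::topological_space measure \<Rightarrow> real \<Rightarrow> (nat \<Rightarrow> 'a \<Rightarrow> real) \<Rightarrow>
    ('a \<Rightarrow> 'v set) \<Rightarrow> ('a \<Rightarrow> ('a \<Rightarrow> real) \<Rightarrow> ('a \<Rightarrow> real) \<Rightarrow> 'v::real_inner) \<Rightarrow>
    (('a \<Rightarrow> real) \<Rightarrow> ('a \<Rightarrow> real) \<Rightarrow> 'h::real_vector) \<Rightarrow> ('h \<Rightarrow> 'a \<Rightarrow> 'v) \<Rightarrow>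
    ('a \<Rightarrow> real) set \<Rightarrow> bool" where
  "core_II m p \<phi> Hx cls \<tau> \<Phi> D \<longleftrightarrow>
     (let S = span {\<tau> f g | f g. f \<in> D \<and> g \<in> D} in
       (\<forall>h\<in>S. \<Phi> h \<in> Lp_sections m p \<phi> Hx cls) \<and>
       (\<forall>\<xi>\<in>Lp_sections m p \<phi> Hx cls. \<forall>e>0. \<exists>h\<in>S. Lp_pow m p (\<lambda>x. \<xi> x - \<Phi> h x) < e))"

definition core_III :: "'a measure \<Rightarrow> real \<Rightarrow>
    (('a \<Rightarrow> real) \<Rightarrow> ('a \<Rightarrow> real) \<Rightarrow> 'a set \<Rightarrow> real) \<Rightarrow> ('a \<Rightarrow> real) set \<Rightarrow> bool" where
  "core_III m p \<Gamma> D \<longleftrightarrow>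
     (\<forall>f\<in>D. signed_abs_cont m (\<Gamma> f f) \<and>
        (\<exists>\<rho>. is_density m (\<Gamma> f f) \<rho> \<and> \<rho> \<in> Lp_fun m (p / 2)))"

definition closable_operator :: "'a::topological_space measure \<Rightarrow> real \<Rightarrow> (nat \<Rightarrow> 'a \<Rightarrow> real) \<Rightarrow>
    ('a \<Rightarrow> 'v set) \<Rightarrow> ('a \<Rightarrow> ('a \<Rightarrow> real) \<Rightarrow> ('a \<Rightarrow> real) \<Rightarrow> 'v::real_inner) \<Rightarrow>
    (('a \<Rightarrow> real) \<Rightarrow> 'a \<Rightarrow> 'v) \<Rightarrow> ('a \<Rightarrow> real) set \<Rightarrow> bool" where
  "closable_operator m p \<phi> Hx cls T D \<longleftrightarrow>
     (\<forall>u v. (\<forall>n. u n \<in> D) \<and> v \<in> Lp_sections m p \<phi> Hx cls \<and>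
        (\<lambda>n. Lp_pow m p (u n)) \<longlonglongrightarrow> 0 \<and>
        (\<lambda>n. Lp_pow m p (\<lambda>x. T (u n) x - v x)) \<longlonglongrightarrow> 0 \<longrightarrow>
        (AE x in m. v x = 0))"

end

theory Submission
  imports Defs
begin

text \<open>
  Write \<open>\<Gamma>(g)\<close> for \<open>\<Gamma> g g\<close>. On a finite measure space with \<open>p > 2\<close>, convergence in \<open>L\<^sub>p\<close> implies
  convergence in \<open>L\<^sub>2\<close>, both for functions and for sections. So if \<open>u n \<rightarrow> 0\<close> in \<open>L\<^sub>p\<close> and the
  differentials of the \<open>u n\<close> converge in \<open>L\<^sub>p\<close> to \<open>v\<close>, then \<open>u n \<rightarrow> 0\<close> in \<open>L\<^sub>2(m)\<close>, and the vectors
  \<open>h n = \<tau> (u n) 1\<close> of \<open>H\<close> converge to the vector \<open>k\<close> that \<open>v\<close> represents. Closability of the form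
  on \<open>L\<^sub>2(m)\<close> should now give \<open>k = 0\<close>; to use it, the norm \<open>\<parallel>h n\<parallel>\<^sup>2 = \<Gamma>(u n)(X)\<close> has to be
  compared with the energy \<open>E (u n) (u n)\<close>.

  For strongly local forms both are equal. In general a killing part enters \<open>\<Gamma>(g)(X)\<close> with the
  factor one half, and the comparison is \<open>E g g / 2 \<le> \<Gamma>(g)(X) \<le> E g g\<close> (lemmas \<open>E_le_energy_mass\<close>
  and \<open>energy_mass_le_E\<close>). It comes from the defining identity of \<open>\<Gamma>\<close>: if \<open>0 \<le> \<eta> \<le> 1\<close> and \<open>\<eta> = 1\<close>
  on the support of \<open>g\<close>, then \<open>\<eta> g = g\<close>, so \<open>2 \<integral> \<eta> d\<Gamma>(g) = 2 E g g - E (g\<^sup>2) \<eta>\<close>, and what is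
  needed is \<open>0 \<le> E (g\<^sup>2) \<eta> \<le> E g g\<close> (lemma \<open>E_square_cutoff\<close>).

  The upper bound on \<open>E (g\<^sup>2) \<eta>\<close> is the heart of the proof. It rests on the unit
  contraction property and closedness, without semigroup or resolvent. Cut \<open>g \<ge> 0\<close> horizontally into layers
  \<open>g\<^sub>k = min ((g - k e)\<^sup>+) e\<close>. Since the lower layers are full wherever a higher one is nonzero,
  contracting perturbations of truncations shows \<open>E g\<^sub>j g\<^sub>k \<ge> 0\<close> and \<open>e E g\<^sub>k \<eta> \<le> E g\<^sub>j g\<^sub>k\<close> for
  \<open>j < k\<close>. Summing over \<open>j < k\<close>, the function \<open>\<Sum>k. 2 k e g\<^sub>k\<close>, which approximates \<open>g\<^sup>2\<close>, has form
  value at most \<open>2 (\<Sum>j<k. E g\<^sub>j g\<^sub>k) \<le> E g g\<close> against \<open>\<eta>\<close>. For layers of height \<open>M / 2\<^sup>n\<close> these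
  approximations are Cauchy for \<open>E\<close> plus the \<open>L\<^sub>2\<close>-norm, so that closedness of the form yields
  \<open>g\<^sup>2 \<in> F\<close> and the bound.

  Finally, \<open>E (u i - u j) \<le> 2 \<parallel>h i - h j\<parallel>\<^sup>2\<close> makes \<open>u\<close> Cauchy for \<open>E\<close>, closability gives
  \<open>E (u n) (u n) \<rightarrow> 0\<close>, and \<open>\<parallel>h n\<parallel>\<^sup>2 \<le> E (u n) (u n)\<close> gives \<open>k = 0\<close>.
\<close>

section \<open>Horizontal layers of a nonnegative number\<close>

text \<open>
  For \<open>s \<ge> 0\<close> this is the part of \<open>s\<close> between the heights \<open>k e\<close> and \<open>(k + 1) e\<close>. Writing it as a
  difference of two truncations makes sums of consecutive layers telescope and keeps layers of
  functions in the domain of a Dirichlet form.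
\<close>

definition layer :: "real \<Rightarrow> nat \<Rightarrow> real \<Rightarrow> real" where
  "layer e k s = min (max s 0) (real (Suc k) * e) - min (max s 0) (real k * e)"

lemma layer_nonneg: "0 \<le> e \<Longrightarrow> 0 \<le> layer e k s"
  by (auto simp: layer_def min_def algebra_simps)

lemma layer_le: "0 \<le> e \<Longrightarrow> layer e k s \<le> e"
  by (auto simp: layer_def min_def algebra_simps)

lemma layer_nonpos_arg: "0 \<le> e \<Longrightarrow> s \<le> 0 \<Longrightarrow> layer e k s = 0"
  by (auto simp: layer_def min_def max_def)

lemma layer_empty: "0 \<le> e \<Longrightarrow> s \<le> real k * e \<Longrightarrow> layer e k s = 0"
  by (auto simp: layer_def min_def max_def algebra_simps)

lemma layer_full: "0 \<le> e \<Longrightarrow> real (Suc k) * e \<le> s \<Longrightarrow> layer e k s = e"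
proof -
  assume e: "0 \<le> e" and s: "real (Suc k) * e \<le> s"
  have "real k * e \<le> real (Suc k) * e" using e by (simp add: algebra_simps)
  moreover have "max s 0 = s" using e s by (simp add: order_trans[of 0 "(1 + real k) * e" s])
  ultimately have "layer e k s = real (Suc k) * e - real k * e"
    using s unfolding layer_def by simp
  then show ?thesis by (simp add: algebra_simps)
qed

lemma layer_filled_below:
  assumes "0 \<le> e" "j < k" "layer e k s \<noteq> 0"
  shows "layer e j s = e"
proof (rule layer_full[OF assms(1)])
  have "real (Suc j) * e \<le> real k * e"
    using assms(1,2) by (intro mult_right_mono) auto
  also have "\<dots> \<le> s" using layer_empty[OF assms(1)] assms(3) by (metis linear)
  finally show "real (Suc j) * e \<le> s" .
qed

lemma sum_layers:
  assumes "0 \<le> s" "s \<le> real N * e"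
  shows "(\<Sum>k<N. layer e k s) = s"
proof -
  have "(\<Sum>k<N. layer e k s) = min (max s 0) (real N * e) - min (max s 0) (real 0 * e)"
    unfolding layer_def by (rule sum_lessThan_telescope)
  then show ?thesis using assms by simp
qed

lemma layer_refine:
  assumes "0 < K"
  shows "layer e k s = (\<Sum>l\<in>{k * K..<k * K + K}. layer (e / real K) l s)"
proof -
  have "(\<Sum>l\<in>{k * K..<k * K + K}. layer (e / real K) l s)
      = min (max s 0) (real (k * K + K) * (e / real K)) - min (max s 0) (real (k * K) * (e / real K))"
    unfolding layer_def by (rule sum_Suc_diff') simp
  also have "real (k * K + K) * (e / real K) = real (Suc k) * e"
    using assms by (simp add: field_simps)
  also have "real (k * K) * (e / real K) = real k * e"
    using assms by simp
  finally show ?thesis by (simp add: layer_def)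
qed

text \<open>
  On \<open>[0, N e]\<close>, the continuous piecewise linear function with slope \<open>2 k e\<close> on the interval from
  \<open>k e\<close> to \<open>(k + 1) e\<close>: the derivative \<open>2 s\<close> of \<open>s\<^sup>2\<close> is replaced by its value at the grid point
  below.
\<close>

definition square_approx :: "nat \<Rightarrow> real \<Rightarrow> real \<Rightarrow> real" where
  "square_approx N e s = (\<Sum>k<N. 2 * real k * e * layer e k s)"

text \<open>
  The slopes of \<open>s\<^sup>2\<close> and of its approximation differ by at most \<open>2 e\<close>; the bound adds this up
  layer by layer.
\<close>

lemma square_approx_error:
  assumes e: "0 \<le> e" and s: "0 \<le> s" "s \<le> real N * e"
  shows "\<bar>s\<^sup>2 - square_approx N e s\<bar> \<le> 2 * e * s"
proof -
  define c where "c k = min (max s 0) (real k * e)" for k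
  have lay: "layer e k s = c (Suc k) - c k" for k by (simp add: layer_def c_def)
  have "(\<Sum>k<N. (c (Suc k))\<^sup>2 - (c k)\<^sup>2) = (c N)\<^sup>2 - (c 0)\<^sup>2"
    by (rule sum_lessThan_telescope)
  also have "c 0 = 0" using s by (simp add: c_def)
  also have "c N = s" using s by (simp add: c_def)
  finally have sq: "s\<^sup>2 = (\<Sum>k<N. (c (Suc k))\<^sup>2 - (c k)\<^sup>2)" by simp
  have layer_error: "\<bar>(c (Suc k))\<^sup>2 - (c k)\<^sup>2 - 2 * real k * e * layer e k s\<bar> \<le> 2 * e * layer e k s" for k
  proof (cases "layer e k s = 0")
    case True
    then show ?thesis using lay by simp
  next
    case False
    then have "real k * e < s" using layer_empty[OF e, of s k] by force
    then have ck: "c k = real k * e" using s by (simp add: c_def)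
    then have cS: "c (Suc k) = real k * e + layer e k s" using lay[of k] by simp
    have "(c (Suc k))\<^sup>2 - (c k)\<^sup>2 - 2 * real k * e * layer e k s = layer e k s * layer e k s"
      unfolding cS ck by (simp add: power2_eq_square algebra_simps)
    moreover have "layer e k s * layer e k s \<le> e * layer e k s"
      using layer_le[OF e] layer_nonneg[OF e] by (intro mult_right_mono)
    moreover have "0 \<le> e * layer e k s" "0 \<le> layer e k s * layer e k s"
      using layer_nonneg[OF e, of k s] e by auto
    ultimately show ?thesis by linarith
  qed
  have "\<bar>s\<^sup>2 - square_approx N e s\<bar>
      = \<bar>\<Sum>k<N. (c (Suc k))\<^sup>2 - (c k)\<^sup>2 - 2 * real k * e * layer e k s\<bar>"
    unfolding sq square_approx_def by (simp add: sum_subtractf)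
  also have "\<dots> \<le> (\<Sum>k<N. 2 * e * layer e k s)"
    using layer_error by (intro order_trans[OF sum_abs] sum_mono) 
  also have "\<dots> = 2 * e * s"
    using sum_layers[OF s] by (simp flip: sum_distrib_left)
  finally show ?thesis .
qed

text \<open>
  The change under refinement of the grid is again a combination of (fine) layers, with
  coefficients in \<open>[0, 2 e]\<close>. Energies of such combinations are controlled by
  \<open>E_layer_combination_le\<close> below.
\<close>

lemma square_approx_refine:
  assumes K: "0 < K"
  shows "square_approx (N * K) (e / real K) s - square_approx N e s
    = (\<Sum>l<N * K. 2 * e * (real (l mod K) / real K) * layer (e / real K) l s)"
proof -
  have "square_approx N e s
      = (\<Sum>k<N. \<Sum>l\<in>{k * K..<k * K + K}. 2 * real (l div K) * e * layer (e / real K) l s)"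
    unfolding square_approx_def
  proof (rule sum.cong[OF refl])
    fix k
    have "l div K = k" if "l \<in> {k * K..<k * K + K}" for l
      using that K by (intro div_nat_eqI) (auto simp: algebra_simps)
    then have "(\<Sum>l\<in>{k * K..<k * K + K}. 2 * real (l div K) * e * layer (e / real K) l s)
       = (\<Sum>l\<in>{k * K..<k * K + K}. 2 * real k * e * layer (e / real K) l s)"
      by (intro sum.cong) auto
    then show "2 * real k * e * layer e k s
       = (\<Sum>l\<in>{k * K..<k * K + K}. 2 * real (l div K) * e * layer (e / real K) l s)"
      by (simp add: layer_refine[OF K, of e k s] sum_distrib_left)
  qed
  also have "\<dots> = (\<Sum>l<N * K. 2 * real (l div K) * e * layer (e / real K) l s)"
    by (rule sum.nat_group)
  finally have "square_approx (N * K) (e / real K) s - square_approx N e s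
     = (\<Sum>l<N * K. (2 * real l * (e / real K) - 2 * real (l div K) * e) * layer (e / real K) l s)"
    by (simp add: square_approx_def sum_subtractf algebra_simps)
  also have "\<dots> = (\<Sum>l<N * K. 2 * e * (real (l mod K) / real K) * layer (e / real K) l s)"
  proof (rule sum.cong[OF refl])
    fix l
    have "real l = real (l div K) * real K + real (l mod K)"
      by (metis div_mult_mod_eq of_nat_add of_nat_mult)
    then have "2 * real l * (e / real K) - 2 * real (l div K) * e = 2 * e * (real (l mod K) / real K)"
      using K by (simp add: field_simps)
    then show "(2 * real l * (e / real K) - 2 * real (l div K) * e) * layer (e / real K) l s
       = 2 * e * (real (l mod K) / real K) * layer (e / real K) l s" by simp
  qed
  finally show ?thesis .
qed

section \<open>Symmetric Dirichlet forms and layers\<close>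


locale dirichlet_form =
  fixes \<mu> :: "'a measure"
    and F :: "('a \<Rightarrow> real) set"
    and E :: "('a \<Rightarrow> real) \<Rightarrow> ('a \<Rightarrow> real) \<Rightarrow> real"
  assumes dirichlet: "symmetric_dirichlet_form \<mu> F E"
begin

lemma zero_in: "(\<lambda>x. 0) \<in> F"
  and add_in: "f \<in> F \<Longrightarrow> g \<in> F \<Longrightarrow> (\<lambda>x. f x + g x) \<in> F"
  and scale_in: "f \<in> F \<Longrightarrow> (\<lambda>x. c * f x) \<in> F"
  using dirichlet unfolding symmetric_dirichlet_form_def fun_subspace_def by blast+

lemma E_sym: "f \<in> F \<Longrightarrow> g \<in> F \<Longrightarrow> E f g = E g f"
  and E_add: "f \<in> F \<Longrightarrow> g \<in> F \<Longrightarrow> h \<in> F \<Longrightarrow> E (\<lambda>x. f x + g x) h = E f h + E g h"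
  and E_scale: "f \<in> F \<Longrightarrow> h \<in> F \<Longrightarrow> E (\<lambda>x. c * f x) h = c * E f h"
  and E_nonneg: "f \<in> F \<Longrightarrow> 0 \<le> E f f"
  and unit_contraction_in: "f \<in> F \<Longrightarrow> (\<lambda>x. min (max (f x) 0) 1) \<in> F"
  and unit_contraction: "f \<in> F \<Longrightarrow>
    E (\<lambda>x. min (max (f x) 0) 1) (\<lambda>x. min (max (f x) 0) 1) \<le> E f f"
  and in_cong_AE: "f \<in> F \<Longrightarrow> g \<in> borel_measurable \<mu> \<Longrightarrow> (AE x in \<mu>. f x = g x) \<Longrightarrow> g \<in> F"
  and E_cong_AE: "f \<in> F \<Longrightarrow> g \<in> borel_measurable \<mu> \<Longrightarrow> (AE x in \<mu>. f x = g x) \<Longrightarrow> h \<in> F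
    \<Longrightarrow> E g h = E f h"
  using dirichlet unfolding symmetric_dirichlet_form_def by blast+

lemma E1_complete:
  assumes "\<And>n. u n \<in> F"
    and "\<And>e. e > 0 \<Longrightarrow> \<exists>N. \<forall>i\<ge>N. \<forall>j\<ge>N. E1 \<mu> E (\<lambda>x. u i x - u j x) < e"
  obtains f where "f \<in> F" "(\<lambda>n. E1 \<mu> E (\<lambda>x. u n x - f x)) \<longlonglongrightarrow> 0"
  using dirichlet assms unfolding symmetric_dirichlet_form_def by blast

lemma measurable_F: "f \<in> F \<Longrightarrow> f \<in> borel_measurable \<mu>"
  using dirichlet unfolding symmetric_dirichlet_form_def Lp_fun_def by blast

lemma square_integrable:
  assumes "f \<in> F" shows "integrable \<mu> (\<lambda>x. (f x)\<^sup>2)"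
proof -
  have "Lp_pow \<mu> 2 f < \<infinity>"
    using dirichlet assms unfolding symmetric_dirichlet_form_def Lp_fun_def by blast
  moreover have "Lp_pow \<mu> 2 f = (\<integral>\<^sup>+x. ennreal ((f x)\<^sup>2) \<partial>\<mu>)"
    unfolding Lp_pow_def by (intro nn_integral_cong) (simp add: powr_numeral)
  ultimately show ?thesis
    using measurable_F[OF assms] by (intro integrableI_nonneg) auto
qed

lemma diff_in: "f \<in> F \<Longrightarrow> g \<in> F \<Longrightarrow> (\<lambda>x. f x - g x) \<in> F"
  using add_in[of f "\<lambda>x. -1 * g x"] scale_in[of g "-1"] by simp

lemma E_diff: "f \<in> F \<Longrightarrow> g \<in> F \<Longrightarrow> h \<in> F \<Longrightarrow> E (\<lambda>x. f x - g x) h = E f h - E g h"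
  using E_add[of f "\<lambda>x. -1 * g x" h] scale_in[of g "-1"] E_scale[of g h "-1"] by simp

lemma sum_in:
  assumes "finite I" "\<And>i. i \<in> I \<Longrightarrow> f i \<in> F"
  shows "(\<lambda>x. \<Sum>i\<in>I. a i * f i x) \<in> F"
  using assms by (induction I) (simp_all add: zero_in add_in scale_in)

lemma E_sum:
  assumes "finite I" "\<And>i. i \<in> I \<Longrightarrow> f i \<in> F" "h \<in> F"
  shows "E (\<lambda>x. \<Sum>i\<in>I. a i * f i x) h = (\<Sum>i\<in>I. a i * E (f i) h)"
  using assms
proof (induction I)
  case empty
  then show ?case using E_scale[OF zero_in, of h 0] by simp
next
  case (insert i I)
  then have "E (\<lambda>x. a i * f i x + (\<Sum>i\<in>I. a i * f i x)) h
      = E (\<lambda>x. a i * f i x) h + E (\<lambda>x. \<Sum>i\<in>I. a i * f i x) h"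
    by (intro E_add scale_in sum_in) auto
  with insert show ?case by (simp add: E_scale)
qed

lemma E_sum_sum:
  assumes "finite I" "\<And>i. i \<in> I \<Longrightarrow> f i \<in> F"
  shows "E (\<lambda>x. \<Sum>i\<in>I. a i * f i x) (\<lambda>x. \<Sum>i\<in>I. a i * f i x)
    = (\<Sum>i\<in>I. \<Sum>j\<in>I. a i * a j * E (f i) (f j))"
proof -
  have "E (f i) (\<lambda>x. \<Sum>j\<in>I. a j * f j x) = (\<Sum>j\<in>I. a j * E (f i) (f j))" if "i \<in> I" for i
    using that assms by (subst E_sym[OF _ sum_in]) (auto simp: E_sum E_sym intro!: sum.cong)
  then show ?thesis
    using assms by (simp add: E_sum sum_in sum_distrib_left mult.assoc)
qed

lemma E_quadratic:
  assumes "f \<in> F" "h \<in> F"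
  shows "E (\<lambda>x. f x + s * h x) (\<lambda>x. f x + s * h x) = E f f + 2 * s * E f h + s\<^sup>2 * E h h"
proof -
  have sh: "(\<lambda>x. s * h x) \<in> F" and fsh: "(\<lambda>x. f x + s * h x) \<in> F"
    using assms by (auto intro: add_in scale_in)
  have "E f (\<lambda>x. f x + s * h x) = E f f + s * E f h"
    using assms sh fsh by (subst E_sym) (auto simp: E_add E_scale E_sym)
  moreover have "E h (\<lambda>x. f x + s * h x) = E f h + s * E h h"
    using assms sh fsh by (subst E_sym) (auto simp: E_add E_scale)
  ultimately show ?thesis
    using assms sh fsh by (simp add: E_add E_scale power2_eq_square algebra_simps)
qed

lemma Cauchy_Schwarz:
  assumes "f \<in> F" "h \<in> F"
  shows "(E f h)\<^sup>2 \<le> E f f * E h h"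
proof -
  have q: "0 \<le> E f f + 2 * s * E f h + s\<^sup>2 * E h h" for s
    using E_nonneg[OF add_in[OF assms(1) scale_in[OF assms(2)]], of s] E_quadratic[OF assms, of s]
    by simp
  show ?thesis
  proof (cases "E h h = 0")
    case True
    have "E f h = 0"
    proof (rule ccontr)
      assume "E f h \<noteq> 0"
      then show False using q[of "- (E f f + 1) / (2 * E f h)"] True by (simp add: field_simps)
    qed
    then show ?thesis using True by simp
  next
    case False
    then have pos: "E h h > 0" using E_nonneg[OF assms(2)] by simp
    have "0 \<le> E f f - (E f h)\<^sup>2 / E h h"
      using q[of "- E f h / E h h"] pos by (simp add: field_simps power2_eq_square)
    then show ?thesis using pos by (simp add: field_simps)
  qed
qed

lemma truncation:
  assumes "f \<in> F" "0 < t"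
  shows "(\<lambda>x. min (max (f x) 0) t) \<in> F"
    and "E (\<lambda>x. min (max (f x) 0) t) (\<lambda>x. min (max (f x) 0) t) \<le> E f f"
proof -
  define g where "g = (\<lambda>x. (1/t) * f x)"
  define c where "c = (\<lambda>x. min (max (g x) 0) 1)"
  have g: "g \<in> F" unfolding g_def by (rule scale_in[OF assms(1)])
  have c: "c \<in> F" "E c c \<le> E g g" 
    using unit_contraction_in[OF g] unit_contraction[OF g] by (auto simp: c_def)
  have eq: "(\<lambda>x. min (max (f x) 0) t) = (\<lambda>x. t * c x)"
    using assms(2) by (auto simp: c_def g_def min_def max_def field_simps zero_le_divide_iff)
  have sc: "E (\<lambda>x. t * h x) (\<lambda>x. t * h x) = t\<^sup>2 * E h h" if "h \<in> F" for h
    using that by (simp add: E_scale scale_in E_sym[of h "\<lambda>x. t * h x"] power2_eq_square)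
  have ff: "E f f = t\<^sup>2 * E g g"
    using sc[OF g] assms(2) by (simp add: g_def)
  show "(\<lambda>x. min (max (f x) 0) t) \<in> F" unfolding eq by (rule scale_in[OF c(1)])
  show "E (\<lambda>x. min (max (f x) 0) t) (\<lambda>x. min (max (f x) 0) t) \<le> E f f"
    unfolding eq ff sc[OF c(1)] using c(2) by (simp add: mult_left_mono)
qed

text \<open>
  If truncation undoes every perturbation of \<open>f\<close> in the direction \<open>h\<close>, then \<open>f\<close> has minimal energy
  along that ray, so the derivative of the energy at \<open>f\<close> in the direction \<open>h\<close> is nonnegative. All
  further sign information about the form is obtained from this observation.
\<close>

lemma E_nonneg_if_contracted:
  assumes f: "f \<in> F" and h: "h \<in> F" and t: "0 < t"
    and stat: "\<And>s x. 0 < s \<Longrightarrow> min (max (f x + s * h x) 0) t = f x"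
  shows "0 \<le> E f h"
proof (rule ccontr)
  assume neg: "\<not> 0 \<le> E f h"
  have ineq: "0 \<le> 2 * E f h + s * E h h" if s: "0 < s" for s
  proof -
    have "E f f \<le> E (\<lambda>x. f x + s * h x) (\<lambda>x. f x + s * h x)"
      using truncation(2)[OF add_in[OF f scale_in[OF h]] t, of s] stat[OF s] by simp
    then have "0 \<le> s * (2 * E f h + s * E h h)"
      by (simp add: E_quadratic[OF f h] power2_eq_square algebra_simps)
    then show ?thesis using s by (simp add: zero_le_mult_iff)
  qed
  \<comment> \<open>Small enough for the first order term to dominate; the \<open>+ 1\<close> covers \<open>E h h = 0\<close>.\<close>
  define s where "s = - E f h / (E h h + 1)"
  have hh: "0 \<le> E h h" by (rule E_nonneg[OF h])
  have "0 < s" using neg hh by (simp add: s_def divide_neg_pos)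
  moreover have "s * E h h \<le> - E f h"
  proof -
    have "s * E h h = - E f h * (E h h / (E h h + 1))" by (simp add: s_def)
    also have "\<dots> \<le> - E f h * 1"
      using neg hh by (intro mult_left_mono) auto
    finally show ?thesis by simp
  qed
  ultimately show False using ineq[of s] neg by simp
qed

lemma layer_in:
  assumes g: "g \<in> F" and e: "0 < e"
  shows "(\<lambda>x. layer e k (g x)) \<in> F"
proof -
  have "(\<lambda>x. min (max (g x) 0) (real k * e)) \<in> F"
  proof (cases "k = 0")
    case True
    then have "(\<lambda>x. min (max (g x) 0) (real k * e)) = (\<lambda>x. 0)" by auto
    then show ?thesis using zero_in by simp
  next
    case False
    then show ?thesis using e by (intro truncation(1)[OF g]) simp
  qed
  moreover have "(\<lambda>x. min (max (g x) 0) (real (Suc k) * e)) \<in> F"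
    using e by (intro truncation(1)[OF g]) simp
  ultimately show ?thesis unfolding layer_def by (rule diff_in[rotated])
qed

text \<open>
  For \<open>j < k\<close> the layer \<open>j\<close> already has its maximal value \<open>e\<close> wherever the layer \<open>k\<close> is nonzero,
  so adding a positive multiple of the layer \<open>k\<close> is undone by truncation at \<open>e\<close>.
\<close>

lemma E_layers_nonneg:
  assumes g: "g \<in> F" and e: "0 < e"
  shows "0 \<le> E (\<lambda>x. layer e j (g x)) (\<lambda>x. layer e k (g x))"
proof -
  have lt: "0 \<le> E (\<lambda>x. layer e j (g x)) (\<lambda>x. layer e k (g x))" if "j < k" for j k
  proof (rule E_nonneg_if_contracted[OF layer_in[OF g e] layer_in[OF g e] e])
    fix s :: real and x assume s: "0 < s"
    show "min (max (layer e j (g x) + s * layer e k (g x)) 0) e = layer e j (g x)"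
    proof (cases "layer e k (g x) = 0")
      case True
      then show ?thesis using layer_nonneg[of e j "g x"] layer_le[of e j "g x"] e by simp
    next
      case False
      then show ?thesis
        using layer_filled_below[of e j k "g x"] that e s layer_nonneg[of e k "g x"] by simp
    qed
  qed
  consider "j < k" | "j = k" | "k < j" by linarith
  then show ?thesis
    using lt[of j k] lt[of k j] E_nonneg[OF layer_in[OF g e]] E_sym[OF layer_in[OF g e] layer_in[OF g e]]
    by cases auto
qed

text \<open>
  The contraction property for piecewise linear functions of \<open>g\<close> with slopes bounded by \<open>c\<close>: as
  the layers have nonnegative mutual energies, replacing the coefficients by \<open>c\<close> can only increase
  the energy.
\<close>

lemma E_layer_combination_le:
  assumes g: "g \<in> F" and e: "0 < e" and bd: "\<And>x. 0 \<le> g x" "\<And>x. g x \<le> real N * e"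
    and a: "\<And>k. k < N \<Longrightarrow> \<bar>a k\<bar> \<le> c"
  shows "E (\<lambda>x. \<Sum>k<N. a k * layer e k (g x)) (\<lambda>x. \<Sum>k<N. a k * layer e k (g x)) \<le> c\<^sup>2 * E g g"
proof -
  define L where "L = (\<lambda>k x. layer e k (g x))"
  have L: "L k \<in> F" for k unfolding L_def by (rule layer_in[OF g e])
  have pos: "0 \<le> E (L j) (L k)" for j k unfolding L_def by (rule E_layers_nonneg[OF g e])
  have geq: "g = (\<lambda>x. \<Sum>k<N. 1 * L k x)"
    using sum_layers[OF bd] by (simp add: L_def)
  have "E (\<lambda>x. \<Sum>k<N. a k * L k x) (\<lambda>x. \<Sum>k<N. a k * L k x)
      = (\<Sum>j<N. \<Sum>k<N. a j * a k * E (L j) (L k))"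
    by (rule E_sum_sum) (auto simp: L)
  also have "\<dots> \<le> (\<Sum>j<N. \<Sum>k<N. c\<^sup>2 * E (L j) (L k))"
  proof (intro sum_mono mult_right_mono[OF _ pos])
    fix j k assume "j \<in> {..<N}" "k \<in> {..<N}"
    then have "\<bar>a j\<bar> * \<bar>a k\<bar> \<le> c * c"
      using a[of j] a[of k] by (intro mult_mono) auto
    then show "a j * a k \<le> c\<^sup>2"
      by (metis abs_ge_self abs_mult order_trans power2_eq_square)
  qed
  also have "\<dots> = c\<^sup>2 * (\<Sum>j<N. \<Sum>k<N. 1 * 1 * E (L j) (L k))"
    by (simp add: sum_distrib_left)
  also have "(\<Sum>j<N. \<Sum>k<N. 1 * 1 * E (L j) (L k)) = E g g"
    unfolding arg_cong2[OF geq geq, of E] by (rule E_sum_sum[symmetric]) (auto simp: L)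
  finally show ?thesis by (simp add: L_def)
qed

lemma square_approx_in:
  assumes "g \<in> F" "0 < e"
  shows "(\<lambda>x. square_approx N e (g x)) \<in> F"
  unfolding square_approx_def by (intro sum_in layer_in assms) auto

text \<open>
  The key estimate. The function \<open>e \<eta> - g\<^sub>j\<close> is nonnegative and vanishes where \<open>g\<^sub>k\<close> is nonzero,
  hence its form value against \<open>g\<^sub>k\<close> is nonpositive: \<open>e E g\<^sub>k \<eta> \<le> E g\<^sub>j g\<^sub>k\<close> for \<open>j < k\<close>. The
  coefficient \<open>2 k e\<close> of \<open>g\<^sub>k\<close> provides this estimate for all \<open>k\<close> lower layers, twice, and the
  resulting sum is the off-diagonal part of \<open>E g g\<close>.
\<close>

lemma E_square_approx_le:
  assumes g: "g \<in> F" and e: "0 < e" and bd: "\<And>x. 0 \<le> g x" "\<And>x. g x \<le> real N * e"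
    and \<eta>: "\<eta> \<in> F" "\<And>x. 0 \<le> \<eta> x" "\<And>x. \<eta> x \<le> 1" "\<And>x. g x \<noteq> 0 \<Longrightarrow> \<eta> x = 1"
  shows "E (\<lambda>x. square_approx N e (g x)) \<eta> \<le> E g g"
proof -
  define L where "L = (\<lambda>k x. layer e k (g x))"
  have L: "L k \<in> F" for k unfolding L_def by (rule layer_in[OF g e])
  have pos: "0 \<le> E (L j) (L k)" for j k unfolding L_def by (rule E_layers_nonneg[OF g e])
  have geq: "g = (\<lambda>x. \<Sum>k<N. 1 * L k x)"
    using sum_layers[OF bd] by (simp add: L_def)
  have below: "e * E (L k) \<eta> \<le> E (L j) (L k)" if "j < k" for j k
  proof -
    let ?f = "\<lambda>x. e * \<eta> x - L j x" and ?h = "\<lambda>x. -1 * L k x"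
    have fF: "?f \<in> F" and hF: "?h \<in> F"
      using \<eta>(1) L by (intro diff_in scale_in; simp)+
    have "0 \<le> E ?f ?h"
    proof (rule E_nonneg_if_contracted[OF fF hF e])
      fix s :: real and x assume s: "0 < s"
      show "min (max (?f x + s * ?h x) 0) e = ?f x"
      proof (cases "g x = 0")
        case True
        then have "L i x = 0" for i
          using e by (simp add: L_def layer_nonpos_arg)
        then show ?thesis using \<eta>(2,3)[of x] e by (simp add: mult_left_le)
      next
        case False
        then have one: "\<eta> x = 1" by (rule \<eta>(4))
        have "0 \<le> L j x" "L j x \<le> e" "0 \<le> L k x"
          using e by (auto simp: L_def layer_nonneg layer_le)
        moreover have "L k x = 0 \<or> L j x = e"
          using layer_filled_below[of e j k "g x"] that e by (auto simp: L_def)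
        ultimately show ?thesis using one e s by auto
      qed
    qed
    moreover have "E ?f ?h = - (e * E (L k) \<eta> - E (L j) (L k))"
      using E_sym[OF fF hF] E_scale[OF L fF, of "-1" k] E_sym[OF L fF, of k]
        E_diff[OF scale_in[OF \<eta>(1)] L L, of e j k] E_scale[OF \<eta>(1) L, of e k]
        E_sym[OF \<eta>(1) L, of k] by simp
    ultimately show ?thesis by simp
  qed
  have "E (\<lambda>x. square_approx N e (g x)) \<eta> = (\<Sum>k<N. 2 * real k * e * E (L k) \<eta>)"
    unfolding square_approx_def using E_sum[of "{..<N}" L \<eta> "\<lambda>k. 2 * real k * e"] L \<eta>(1)
    by (simp add: L_def)
  also have "\<dots> \<le> (\<Sum>k<N. 2 * (\<Sum>j<k. E (L j) (L k)))"
  proof (rule sum_mono)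
    fix k
    have "(\<Sum>j<k. e * E (L k) \<eta>) \<le> (\<Sum>j<k. E (L j) (L k))"
      by (intro sum_mono below) simp
    then show "2 * real k * e * E (L k) \<eta> \<le> 2 * (\<Sum>j<k. E (L j) (L k))" by simp
  qed
  also have "\<dots> \<le> (\<Sum>j<N. \<Sum>k<N. E (L j) (L k))"
  proof (induction N)
    case 0
    then show ?case by simp
  next
    case (Suc N)
    have "(\<Sum>j<Suc N. \<Sum>k<Suc N. E (L j) (L k))
       = (\<Sum>j<N. \<Sum>k<N. E (L j) (L k)) + (\<Sum>j<N. E (L j) (L N)) + (\<Sum>j<N. E (L N) (L j)) + E (L N) (L N)"
      by (simp add: sum.distrib)
    moreover have "(\<Sum>j<N. E (L N) (L j)) = (\<Sum>j<N. E (L j) (L N))"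
      by (intro sum.cong refl E_sym L)
    ultimately show ?case using Suc pos[of N N] by simp
  qed
  also have "\<dots> = (\<Sum>j<N. \<Sum>k<N. 1 * 1 * E (L j) (L k))" by simp
  also have "\<dots> = E g g"
    unfolding arg_cong2[OF geq geq, of E] by (rule E_sum_sum[symmetric]) (auto simp: L)
  finally show ?thesis .
qed

lemma E_diff_swap:
  assumes "f \<in> F" "g \<in> F"
  shows "E (\<lambda>x. f x - g x) (\<lambda>x. f x - g x) = E (\<lambda>x. g x - f x) (\<lambda>x. g x - f x)"
  using E_quadratic[OF assms, of "-1"] E_quadratic[OF assms(2,1), of "-1"] E_sym[OF assms]
  by simp

text \<open>
  Both parts of the norm are controlled by the mesh \<open>M / 2\<^sup>i\<close> of the coarser grid: the energy
  because the difference is a layer combination with small coefficients, the \<open>L\<^sub>2\<close>-part by the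
  pointwise approximation error.
\<close>

lemma square_approx_E1_diff_le:
  assumes g: "g \<in> F" and M: "0 < M" and bd: "\<And>x. 0 \<le> g x" "\<And>x. g x \<le> M"
    and ij: "i \<le> j"
  defines "u \<equiv> \<lambda>n x. square_approx (2 ^ n) (M / 2 ^ n) (g x)"
  shows "E1 \<mu> E (\<lambda>x. u i x - u j x) \<le> 16 * (M / 2 ^ i)\<^sup>2 * E1 \<mu> E g"
proof -
  define e where "e = M / 2 ^ i"
  define K :: nat where "K = 2 ^ (j - i)"
  have e: "0 < e" and K: "0 < K" using M by (auto simp: e_def K_def)
  have NK: "2 ^ j = (2 ^ i * K :: nat)" and eK: "M / 2 ^ j = e / real K"
    using ij by (simp_all add: K_def e_def flip: power_add)
  have un: "u n \<in> F" for n unfolding u_def using M by (intro square_approx_in[OF g]) simp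
  have bdn: "g x \<le> real (2 ^ n) * (M / 2 ^ n)" for n x using bd(2)[of x] by simp
  have Eji: "E (\<lambda>x. u j x - u i x) (\<lambda>x. u j x - u i x) \<le> (2 * e)\<^sup>2 * E g g"
  proof -
    have eq: "(\<lambda>x. u j x - u i x)
        = (\<lambda>x. \<Sum>l<2 ^ i * K. 2 * e * (real (l mod K) / real K) * layer (e / real K) l (g x))"
      unfolding u_def NK eK unfolding e_def[symmetric] square_approx_refine[OF K] ..
    have "\<bar>2 * e * (real (l mod K) / real K)\<bar> \<le> 2 * e" for l
    proof -
      have "real (l mod K) / real K \<le> 1" using K by (simp add: order.strict_implies_order)
      then have "2 * e * (real (l mod K) / real K) \<le> 2 * e * 1"
        using e by (intro mult_left_mono) auto
      then show ?thesis using e by simp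
    qed
    then show ?thesis unfolding eq using e K bd(1) bdn[of _ j]
      by (intro E_layer_combination_le[OF g]) (auto simp: NK eK simp del: times_divide_eq_right)
  qed
  then have Ele: "E (\<lambda>x. u i x - u j x) (\<lambda>x. u i x - u j x) \<le> 16 * e\<^sup>2 * E g g"
  proof -
    have "(2 * e)\<^sup>2 * E g g \<le> 16 * e\<^sup>2 * E g g"
      using E_nonneg[OF g] by (intro mult_right_mono) (auto simp: power_mult_distrib)
    from order_trans[OF Eji this] show ?thesis
      unfolding E_diff_swap[OF un un, of i j] .
  qed
  have L2: "(LINT x|\<mu>. (u i x - u j x)\<^sup>2) \<le> (LINT x|\<mu>. 16 * e\<^sup>2 * (g x)\<^sup>2)"
  proof (rule integral_mono)
    show "integrable \<mu> (\<lambda>x. (u i x - u j x)\<^sup>2)"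
      by (intro square_integrable diff_in un)
    show "integrable \<mu> (\<lambda>x. 16 * e\<^sup>2 * (g x)\<^sup>2)"
      using square_integrable[OF g] by simp
    fix x
    have err: "\<bar>(g x)\<^sup>2 - u n x\<bar> \<le> 2 * (M / 2 ^ n) * g x" for n
      unfolding u_def using M by (intro square_approx_error bd bdn) simp
    have "M / 2 ^ j \<le> e"
      using M ij unfolding e_def by (intro divide_left_mono power_increasing) auto
    then have "2 * (M / 2 ^ j) * g x \<le> 2 * e * g x" using bd(1)[of x] by (intro mult_right_mono) auto
    then have "\<bar>u i x - u j x\<bar> \<le> 4 * e * g x"
      using err[of i] err[of j] unfolding e_def[symmetric] by linarith
    then have "\<bar>u i x - u j x\<bar>\<^sup>2 \<le> (4 * e * g x)\<^sup>2" by (intro power_mono) auto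
    then show "(u i x - u j x)\<^sup>2 \<le> 16 * e\<^sup>2 * (g x)\<^sup>2" by (simp add: power_mult_distrib)
  qed
  then show ?thesis using Ele unfolding E1_def e_def[symmetric]
    by (simp add: algebra_simps)
qed

text \<open>
  The approximations of \<open>g\<^sup>2\<close> have a limit in the domain by closedness of the form, and by the
  pointwise error bound this limit agrees with \<open>g\<^sup>2\<close> almost everywhere.
\<close>

lemma square_approx_limit:
  assumes g: "g \<in> F" and M: "0 < M" and bd: "\<And>x. 0 \<le> g x" "\<And>x. g x \<le> M"
  shows "(\<lambda>x. (g x)\<^sup>2) \<in> F"
    and "h \<in> F \<Longrightarrow> (\<lambda>n. E (\<lambda>x. square_approx (2 ^ n) (M / 2 ^ n) (g x)) h)
      \<longlonglongrightarrow> E (\<lambda>x. (g x)\<^sup>2) h"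
proof -
  define u where "u = (\<lambda>n::nat. \<lambda>x. square_approx (2 ^ n) (M / 2 ^ n) (g x))"
  have un: "u n \<in> F" for n unfolding u_def using M by (intro square_approx_in[OF g]) simp
  have bdn: "g x \<le> real (2 ^ n) * (M / 2 ^ n)" for n x using bd(2)[of x] by simp
  have lim0: "(\<lambda>n. c * (M / 2 ^ n)\<^sup>2) \<longlonglongrightarrow> 0" for c :: real
  proof -
    have "(\<lambda>n. c * M\<^sup>2 * ((1/4) ^ n)) \<longlonglongrightarrow> c * M\<^sup>2 * 0"
      by (intro tendsto_mult_left LIMSEQ_realpow_zero) auto
    moreover have "(\<lambda>n. c * (M / 2 ^ n)\<^sup>2) = (\<lambda>n. c * M\<^sup>2 * ((1/4) ^ n))"
      by (simp add: fun_eq_iff power_divide power2_eq_square flip: power_mult_distrib)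
    ultimately show ?thesis by simp
  qed
  have E1_swap: "E1 \<mu> E (\<lambda>x. u i x - u j x) = E1 \<mu> E (\<lambda>x. u j x - u i x)" for i j
    unfolding E1_def using E_diff_swap[OF un un, of i j] by (simp add: power2_commute)
  have "\<exists>N. \<forall>i\<ge>N. \<forall>j\<ge>N. E1 \<mu> E (\<lambda>x. u i x - u j x) < e" if e: "e > 0" for e
  proof -
    from order_tendstoD(2)[OF lim0[of "16 * E1 \<mu> E g"] e]
    obtain N where N: "\<And>n. n \<ge> N \<Longrightarrow> 16 * E1 \<mu> E g * (M / 2 ^ n)\<^sup>2 < e"
      by (auto simp: eventually_sequentially)
    have *: "E1 \<mu> E (\<lambda>x. u i x - u j x) < e" if "N \<le> i" "i \<le> j" for i j
      using square_approx_E1_diff_le[OF g M bd that(2)] N[OF that(1)]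
      unfolding u_def by (simp add: mult.assoc mult.left_commute mult.commute)
    have "E1 \<mu> E (\<lambda>x. u i x - u j x) < e" if "N \<le> i" "N \<le> j" for i j
      using *[of i j] *[of j i] that E1_swap[of i j] by (cases "i \<le> j") auto
    then show ?thesis by blast
  qed
  from E1_complete[of u, OF un this] obtain f where f: "f \<in> F"
    and conv: "(\<lambda>n. E1 \<mu> E (\<lambda>x. u n x - f x)) \<longlonglongrightarrow> 0" by blast
  have E0: "0 \<le> E (\<lambda>x. u n x - f x) (\<lambda>x. u n x - f x)" for n
    by (intro E_nonneg diff_in un f)
  have I0: "0 \<le> (LINT x|\<mu>. (u n x - f x)\<^sup>2)" for n by simp
  have Econv: "(\<lambda>n. E (\<lambda>x. u n x - f x) (\<lambda>x. u n x - f x)) \<longlonglongrightarrow> 0"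
    using E0 I0 by (intro tendsto_sandwich[OF _ _ tendsto_const conv]) (auto simp: E1_def)
  have Iconv: "(\<lambda>n. LINT x|\<mu>. (u n x - f x)\<^sup>2) \<longlonglongrightarrow> 0"
    using E0 I0 by (intro tendsto_sandwich[OF _ _ tendsto_const conv]) (auto simp: E1_def)
  have meas [measurable]: "f \<in> borel_measurable \<mu>" "g \<in> borel_measurable \<mu>"
    using f g by (auto intro: measurable_F)
  define D where "D = (\<lambda>x. (f x - (g x)\<^sup>2)\<^sup>2)"
  define R where "R = (\<lambda>n x. 2 * (u n x - f x)\<^sup>2 + 8 * (M / 2 ^ n)\<^sup>2 * (g x)\<^sup>2)"
  have Dbound: "D x \<le> R n x" for n x
  proof -
    have "\<bar>(g x)\<^sup>2 - u n x\<bar> \<le> 2 * (M / 2 ^ n) * g x"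
      unfolding u_def using M by (intro square_approx_error bd bdn) simp
    then have "\<bar>(g x)\<^sup>2 - u n x\<bar>\<^sup>2 \<le> (2 * (M / 2 ^ n) * g x)\<^sup>2" by (intro power_mono) auto
    then have a: "(u n x - (g x)\<^sup>2)\<^sup>2 \<le> 4 * (M / 2 ^ n)\<^sup>2 * (g x)\<^sup>2"
      by (simp only: power2_abs power_mult_distrib power2_commute) simp
    have "D x \<le> 2 * (u n x - f x)\<^sup>2 + 2 * (u n x - (g x)\<^sup>2)\<^sup>2"
      using zero_le_power2[of "(u n x - f x) + (u n x - (g x)\<^sup>2)"]
      unfolding D_def power2_eq_square by (simp add: algebra_simps)
    with a show ?thesis unfolding R_def by simp
  qed
  have Rint: "integrable \<mu> (R n)" for n
    unfolding R_def
    by (intro Bochner_Integration.integrable_add integrable_mult_right square_integrable diff_in un f g)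
  have Dint: "integrable \<mu> D"
  proof (rule Bochner_Integration.integrable_bound[OF Rint[of 0]])
    show "D \<in> borel_measurable \<mu>" unfolding D_def by measurable
    have "0 \<le> D x" for x by (simp add: D_def)
    then show "AE x in \<mu>. norm (D x) \<le> norm (R 0 x)"
      using Dbound[of _ 0] by (intro AE_I2) (metis order_trans real_norm_def abs_of_nonneg)
  qed
  have "(LINT x|\<mu>. D x) \<le> 2 * (LINT x|\<mu>. (u n x - f x)\<^sup>2) + 8 * (LINT x|\<mu>. (g x)\<^sup>2) * (M / 2 ^ n)\<^sup>2" for n
  proof -
    have "(LINT x|\<mu>. D x) \<le> (LINT x|\<mu>. R n x)" by (intro integral_mono Dint Rint Dbound)
    also have "\<dots> = 2 * (LINT x|\<mu>. (u n x - f x)\<^sup>2) + 8 * (M / 2 ^ n)\<^sup>2 * (LINT x|\<mu>. (g x)\<^sup>2)"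
      unfolding R_def
      by (subst Bochner_Integration.integral_add)
        (auto intro!: integrable_mult_right square_integrable diff_in un f g simp del: integrable_mult_right_iff)
    finally show ?thesis by (simp add: algebra_simps)
  qed
  moreover have "(\<lambda>n. 2 * (LINT x|\<mu>. (u n x - f x)\<^sup>2) + 8 * (LINT x|\<mu>. (g x)\<^sup>2) * (M / 2 ^ n)\<^sup>2)
     \<longlonglongrightarrow> 2 * 0 + 0"
    by (intro tendsto_add tendsto_mult_left Iconv lim0)
  ultimately have "(LINT x|\<mu>. D x) \<le> 2 * 0 + 0" by (intro LIMSEQ_le_const) auto
  moreover have "0 \<le> (LINT x|\<mu>. D x)" by (simp add: D_def)
  ultimately have "(LINT x|\<mu>. D x) = 0" by simp
  then have "AE x in \<mu>. D x = 0"
    using integral_nonneg_eq_0_iff_AE[OF Dint] by (simp add: D_def)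
  then have ae: "AE x in \<mu>. f x = (g x)\<^sup>2" by (simp add: D_def)
  have gm: "(\<lambda>x. (g x)\<^sup>2) \<in> borel_measurable \<mu>" by measurable
  show "(\<lambda>x. (g x)\<^sup>2) \<in> F" by (rule in_cong_AE[OF f gm ae])
  show "(\<lambda>n. E (\<lambda>x. square_approx (2 ^ n) (M / 2 ^ n) (g x)) h) \<longlonglongrightarrow> E (\<lambda>x. (g x)\<^sup>2) h"
    if h: "h \<in> F"
  proof -
    have "(\<lambda>n. sqrt (E (\<lambda>x. u n x - f x) (\<lambda>x. u n x - f x) * E h h)) \<longlonglongrightarrow> sqrt (0 * E h h)"
      by (intro tendsto_real_sqrt tendsto_mult_right Econv)
    then have lim: "(\<lambda>n. sqrt (E (\<lambda>x. u n x - f x) (\<lambda>x. u n x - f x) * E h h)) \<longlonglongrightarrow> 0" by simp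
    have "norm (E (u n) h - E f h) \<le> sqrt (E (\<lambda>x. u n x - f x) (\<lambda>x. u n x - f x) * E h h)" for n
      using Cauchy_Schwarz[OF diff_in[OF un f] h, of n] E_diff[OF un f h, of n]
      by (intro real_le_rsqrt) simp
    then have "(\<lambda>n. E (u n) h - E f h) \<longlonglongrightarrow> 0"
      by (intro Lim_null_comparison[OF _ lim] always_eventually) simp
    then have "(\<lambda>n. E (u n) h) \<longlonglongrightarrow> E f h" by (simp add: LIM_zero_iff)
    then show ?thesis unfolding u_def E_cong_AE[OF f gm ae h] .
  qed
qed

lemma E_square_le_nonneg:
  assumes g: "g \<in> F" and M: "0 < M" and bd: "\<And>x. 0 \<le> g x" "\<And>x. g x \<le> M"
    and \<eta>: "\<eta> \<in> F" "\<And>x. 0 \<le> \<eta> x" "\<And>x. \<eta> x \<le> 1" "\<And>x. g x \<noteq> 0 \<Longrightarrow> \<eta> x = 1"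
  shows "E (\<lambda>x. (g x)\<^sup>2) \<eta> \<le> E g g"
proof (rule LIMSEQ_le_const2[OF square_approx_limit(2)[OF g M bd \<eta>(1)]])
  show "\<exists>N. \<forall>n\<ge>N. E (\<lambda>x. square_approx (2 ^ n) (M / 2 ^ n) (g x)) \<eta> \<le> E g g"
    using M bd by (intro exI[of _ 0] allI impI E_square_approx_le[OF g _ _ _ \<eta>]) auto
qed

text \<open>
  The lower bound holds because \<open>\<eta>\<close> attains its maximal value \<open>1\<close> wherever \<open>g\<^sup>2\<close> is nonzero. For
  the upper bound \<open>g\<close> is split into positive and negative part, whose mutual energy is
  nonpositive.
\<close>

lemma E_square_cutoff:
  assumes g: "g \<in> F" and bd: "\<And>x. \<bar>g x\<bar> \<le> M"
    and \<eta>: "\<eta> \<in> F" "\<And>x. 0 \<le> \<eta> x" "\<And>x. \<eta> x \<le> 1" "\<And>x. g x \<noteq> 0 \<Longrightarrow> \<eta> x = 1"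
  shows "0 \<le> E (\<lambda>x. (g x)\<^sup>2) \<eta>" and "E (\<lambda>x. (g x)\<^sup>2) \<eta> \<le> E g g"
proof -
  \<comment> \<open>A strictly positive bound, as required of truncation heights.\<close>
  define B where "B = \<bar>M\<bar> + 1"
  have B: "0 < B" and gB: "\<bar>g x\<bar> \<le> B" for x using bd[of x] by (auto simp: B_def)
  define p where "p = (\<lambda>x. min (max (g x) 0) B)"
  define q where "q = (\<lambda>x. min (max (-1 * g x) 0) B)"
  have p: "p \<in> F" and q: "q \<in> F"
    unfolding p_def q_def by (intro truncation(1) scale_in g B)+
  have pq: "0 \<le> p x" "p x \<le> B" "0 \<le> q x" "q x \<le> B" "p x = 0 \<or> q x = 0" "g x = p x - q x" for x
    using gB[of x] B by (auto simp: p_def q_def)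
  have p2: "(\<lambda>x. (p x)\<^sup>2) \<in> F" and q2: "(\<lambda>x. (q x)\<^sup>2) \<in> F"
    by (rule square_approx_limit(1)[OF _ B]; fact p q pq)+
  have g2: "(\<lambda>x. (g x)\<^sup>2) = (\<lambda>x. (p x)\<^sup>2 + (q x)\<^sup>2)"
  proof
    fix x show "(g x)\<^sup>2 = (p x)\<^sup>2 + (q x)\<^sup>2" using pq(5,6)[of x] by auto
  qed
  have split: "E (\<lambda>x. (g x)\<^sup>2) \<eta> = E (\<lambda>x. (p x)\<^sup>2) \<eta> + E (\<lambda>x. (q x)\<^sup>2) \<eta>"
    unfolding g2 by (rule E_add[OF p2 q2 \<eta>(1)])
  have p_one: "\<eta> x = 1" if "p x \<noteq> 0" for x
    using \<eta>(4)[of x] pq(5,6)[of x] that by auto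
  have q_one: "\<eta> x = 1" if "q x \<noteq> 0" for x
    using \<eta>(4)[of x] pq(5,6)[of x] that by auto
  have nn: "0 \<le> E (\<lambda>x. (r x)\<^sup>2) \<eta>" if r: "(\<lambda>x. (r x)\<^sup>2) \<in> F" and one: "\<And>x. r x \<noteq> 0 \<Longrightarrow> \<eta> x = 1" for r
  proof -
    have "0 \<le> E \<eta> (\<lambda>x. (r x)\<^sup>2)"
    proof (rule E_nonneg_if_contracted[OF \<eta>(1) r zero_less_one])
      fix s :: real and x assume "0 < s"
      then show "min (max (\<eta> x + s * (r x)\<^sup>2) 0) 1 = \<eta> x"
        using \<eta>(2,3)[of x] one[of x] by (cases "r x = 0") auto
    qed
    then show ?thesis using E_sym[OF \<eta>(1) r] by simp
  qed
  show "0 \<le> E (\<lambda>x. (g x)\<^sup>2) \<eta>"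
    using nn[OF p2 p_one] nn[OF q2 q_one] split by simp
  have "E (\<lambda>x. (p x)\<^sup>2) \<eta> \<le> E p p" "E (\<lambda>x. (q x)\<^sup>2) \<eta> \<le> E q q"
    using pq \<eta> p_one q_one by (auto intro!: E_square_le_nonneg[OF _ B] p q)
  moreover have "0 \<le> E p (\<lambda>x. -1 * q x)"
  proof (rule E_nonneg_if_contracted[OF p scale_in[OF q] B])
    fix s :: real and x assume "0 < s"
    then show "min (max (p x + s * (-1 * q x)) 0) B = p x"
      using pq[of x] by auto
  qed
  moreover have "E g g = E p p + 2 * E p (\<lambda>x. -1 * q x) + E q q"
  proof -
    have "g = (\<lambda>x. p x + (-1) * q x)" using pq(6) by auto
    then have "E g g = E p p + 2 * (-1) * E p q + E q q"
      using E_quadratic[OF p q, of "-1"] by simp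
    moreover have "E p (\<lambda>x. -1 * q x) = - E p q"
      using E_sym[OF p scale_in[OF q, of "-1"]] E_scale[OF q p, of "-1"] E_sym[OF p q] by simp
    ultimately show ?thesis by simp
  qed
  ultimately show "E (\<lambda>x. (g x)\<^sup>2) \<eta> \<le> E g g" using split by simp
qed

end

section \<open>Cutoff functions and comparison of measures\<close>

text \<open>
  The value \<open>2\<close> leaves room for a uniform approximation with error below \<open>1\<close>, after which a
  truncation at \<open>1\<close> produces a cutoff function.
\<close>

lemma compact_imp_C0_fun_above:
  fixes K :: "'a::metric_space set"
  assumes "locally compact (UNIV :: 'a set)" and K: "compact K"
  shows "\<exists>f\<in>C0_fun. \<forall>x\<in>K. (2::real) \<le> f x"
proof -
  obtain u v where "\<And>x. x \<in> (UNIV :: 'a set) \<Longrightarrow>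
      x \<in> u x \<and> u x \<subseteq> v x \<and> v x \<subseteq> UNIV \<and> openin (top_of_set UNIV) (u x) \<and> compact (v x)"
    using locally_compactE[OF assms(1)] by blast
  then have uv: "\<And>x. x \<in> u x" "\<And>x. u x \<subseteq> v x" "\<And>x. open (u x)" "\<And>x. compact (v x)"
    by auto
  have "K \<subseteq> (\<Union>x\<in>UNIV. u x)" using uv(1) by blast
  from compactE_image[OF K uv(3) this] obtain D where D: "finite D" "K \<subseteq> (\<Union>x\<in>D. u x)" .
  define U where "U = (\<Union>x\<in>D. u x)"
  define V where "V = (\<Union>x\<in>D. v x)"
  have U: "open U" "K \<subseteq> U" "U \<subseteq> V" 
    using uv(2,3) D(2) unfolding U_def V_def by auto
  have V: "compact V" unfolding V_def using D(1) uv(4) by (intro compact_UN)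
  have supp: "compact (closure {x. f x \<noteq> 0})" if "{x. f x \<noteq> 0} \<subseteq> U" for f :: "'a \<Rightarrow> real"
  proof -
    have "closure {x. f x \<noteq> 0} \<subseteq> V"
      using that U(3) by (intro closure_minimal compact_imp_closed[OF V]) auto
    then show ?thesis
      using compact_Int_closed[OF V closed_closure, of "{x. f x \<noteq> 0}"] by (simp add: Int_absorb1)
  qed
  consider "K = {}" | "U = UNIV" | "K \<noteq> {}" "- U \<noteq> {}" by blast
  then show ?thesis
  proof cases
    case 1
    then show ?thesis by (intro bexI[of _ "\<lambda>x. 0"]) (auto simp: C0_fun_def)
  next
    case 2
    then show ?thesis using supp[of "\<lambda>x. 2"] by (intro bexI[of _ "\<lambda>x. 2"]) (auto simp: C0_fun_def)
  next
    case 3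
    define h where "h = (\<lambda>x. infdist x (- U))"
    have cont: "continuous_on S h" for S
      unfolding h_def by (intro continuous_on_infdist continuous_on_id)
    obtain x0 where x0: "x0 \<in> K" "\<And>x. x \<in> K \<Longrightarrow> h x0 \<le> h x"
      using continuous_attains_inf[OF K 3(1) cont] by blast
    have "0 < h x0"
      unfolding h_def using U(1,2) x0(1) 3(2) by (intro infdist_pos_not_in_closed) auto
    moreover have "h x = 0" if "x \<notin> U" for x using that by (simp add: h_def)
    ultimately show ?thesis using x0(2) cont
      by (intro bexI[of _ "\<lambda>x. 2 / h x0 * h x"])
        (auto simp: C0_fun_def field_simps intro!: supp continuous_intros)
  qed
qed

lemma C0_fun_bounded:
  assumes "g \<in> C0_fun"
  obtains M where "\<And>x. \<bar>g x\<bar> \<le> M"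
proof -
  have g: "continuous_on UNIV g" "compact (closure {x. g x \<noteq> 0})"
    using assms by (simp_all add: C0_fun_def)
  have "compact (g ` closure {x. g x \<noteq> 0})"
    by (intro compact_continuous_image g(2) continuous_on_subset[OF g(1) subset_UNIV])
  then have "bounded (g ` closure {x. g x \<noteq> 0})" by (rule compact_imp_bounded)
  then obtain M where M: "\<forall>y\<in>g ` closure {x. g x \<noteq> 0}. \<bar>y\<bar> \<le> M"
    unfolding bounded_real by blast
  have "\<bar>g x\<bar> \<le> \<bar>M\<bar>" for x
  proof (cases "g x = 0")
    case False
    then have "x \<in> closure {x. g x \<noteq> 0}" by (intro subsetD[OF closure_subset]) simp
    then have "\<bar>g x\<bar> \<le> M" using M by simp
    then show ?thesis by simp
  qed simp
  then show ?thesis by (rule that)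
qed

lemma integral_mono_measure_borel:
  fixes f :: "'a::topological_space \<Rightarrow> real"
  assumes M: "sets M = sets borel" "finite_measure M" and N: "sets N = sets borel" "finite_measure N"
    and le: "\<And>B. B \<in> sets borel \<Longrightarrow> measure N B \<le> measure M B"
    and f: "f \<in> borel_measurable borel" "\<And>x. 0 \<le> f x" "\<And>x. f x \<le> c"
  shows "(LINT x|N. f x) \<le> (LINT x|M. f x)"
proof -
  have fin: "integrable P f" "f \<in> borel_measurable P"
    if "sets P = sets borel" "finite_measure P" for P
  proof -
    interpret finite_measure P by fact
    show m: "f \<in> borel_measurable P" using f(1) by (simp add: measurable_cong_sets[OF that(1) refl])
    have "norm (f x) \<le> c" for x using f(2,3)[of x] by simp
    then show "integrable P f" by (intro integrable_const_bound[of _ c] m) auto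
  qed
  have "N \<le> M"
  proof -
    have "emeasure N B \<le> emeasure M B" for B
    proof (cases "B \<in> sets borel")
      case True
      then show ?thesis using M(2) N(2) le by (simp add: finite_measure.emeasure_eq_measure)
    next
      case False
      then show ?thesis using M(1) N(1) by (simp add: emeasure_notin_sets)
    qed
    moreover have "sets N = sets M" using M(1) N(1) by simp
    ultimately show ?thesis
      using sets_eq_imp_space_eq[of N M] by (simp add: le_measure_iff le_fun_def)
  qed
  then have "(\<integral>\<^sup>+x. ennreal (f x) \<partial>N) \<le> (\<integral>\<^sup>+x. ennreal (f x) \<partial>M)"
    using M N by (intro nn_integral_mono_measure) auto
  then show ?thesis
    using f(2) fin[OF M] fin[OF N] by (simp add: nn_integral_eq_integral ennreal_le_iff integral_nonneg)
qed

section \<open>Total mass of the energy measure and energy\<close>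


locale regular_dirichlet_form = dirichlet_form \<mu> F E
  for \<mu> :: "'a::{metric_space, second_countable_topology} measure" and F E +
  fixes \<Gamma> :: "('a \<Rightarrow> real) \<Rightarrow> ('a \<Rightarrow> real) \<Rightarrow> 'a set \<Rightarrow> real"
  assumes locally_compact: "locally compact (UNIV :: 'a set)"
    and regular: "regular_form \<mu> F E"
    and energy: "energy_measures F E \<Gamma>"
begin

lemma cutoff_in_core:
  assumes "compact K"
  obtains \<eta> where "\<eta> \<in> form_core F" "\<And>x. 0 \<le> \<eta> x" "\<And>x. \<eta> x \<le> 1" "\<And>x. x \<in> K \<Longrightarrow> \<eta> x = 1"
proof -
  obtain f where f: "f \<in> C0_fun" "\<And>x. x \<in> K \<Longrightarrow> 2 \<le> f x"
    using compact_imp_C0_fun_above[OF locally_compact assms] by blast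
  obtain w where w: "w \<in> form_core F" "\<And>x. \<bar>f x - w x\<bar> < 1"
    using regular f(1) unfolding regular_form_def by (meson zero_less_one)
  define \<eta> where "\<eta> = (\<lambda>x. min (max (w x) 0) 1)"
  have wc: "w \<in> F" "continuous_on UNIV w" "compact (closure {x. w x \<noteq> 0})"
    using w(1) by (auto simp: form_core_def C0_fun_def)
  have "closure {x. \<eta> x \<noteq> 0} \<subseteq> closure {x. w x \<noteq> 0}"
    by (intro closure_mono) (auto simp: \<eta>_def)
  then have "compact (closure {x. \<eta> x \<noteq> 0})"
    using compact_Int_closed[OF wc(3) closed_closure, of "{x. \<eta> x \<noteq> 0}"] by (simp add: Int_absorb1)
  moreover have "continuous_on UNIV \<eta>"
    unfolding \<eta>_def by (intro continuous_intros wc(2))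
  ultimately have "\<eta> \<in> form_core F"
    using unit_contraction_in[OF wc(1)] by (simp add: form_core_def C0_fun_def \<eta>_def)
  moreover have "\<eta> x = 1" if "x \<in> K" for x
    using f(2)[OF that] w(2)[of x] by (simp add: \<eta>_def)
  moreover have "0 \<le> \<eta> x" "\<eta> x \<le> 1" for x by (auto simp: \<eta>_def)
  ultimately show ?thesis by (intro that[of \<eta>])
qed

lemma energy_measure_decomposition:
  assumes "g \<in> form_core F"
  obtains M N where "signed_decomposition (\<Gamma> g g) M N"
    and "\<And>f. signed_integral (\<Gamma> g g) f = (LINT x|M. f x) - (LINT x|N. f x)"
    and "\<And>B. B \<in> sets borel \<Longrightarrow> measure N B \<le> measure M B"
proof -
  define MN where "MN = (SOME MN. signed_decomposition (\<Gamma> g g) (fst MN) (snd MN))"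
  have "\<exists>MN. signed_decomposition (\<Gamma> g g) (fst MN) (snd MN)"
    using energy assms unfolding energy_measures_def finite_signed_radon_def by simp
  then have dec: "signed_decomposition (\<Gamma> g g) (fst MN) (snd MN)"
    unfolding MN_def by (rule someI_ex)
  moreover have "measure (snd MN) B \<le> measure (fst MN) B" if "B \<in> sets borel" for B
    using energy assms that dec unfolding energy_measures_def signed_decomposition_def by force
  ultimately show ?thesis
    by (intro that[of "fst MN" "snd MN"]) (auto simp: signed_integral_def MN_def Let_def)
qed

text \<open>
  As \<open>\<eta> g = g\<close>, the identity that defines \<open>\<Gamma> g g\<close> reads \<open>2 \<integral> \<eta> d\<Gamma>(g) = 2 E g g - E (g\<^sup>2) \<eta>\<close>.
\<close>

lemma signed_integral_cutoff:
  assumes g: "g \<in> form_core F" and \<eta>: "\<eta> \<in> form_core F" "\<And>x. 0 \<le> \<eta> x" "\<And>x. \<eta> x \<le> 1"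
    and one: "\<And>x. g x \<noteq> 0 \<Longrightarrow> \<eta> x = 1"
  shows "E g g / 2 \<le> signed_integral (\<Gamma> g g) \<eta>" and "signed_integral (\<Gamma> g g) \<eta> \<le> E g g"
proof -
  have gF: "g \<in> F" and \<eta>F: "\<eta> \<in> F" using g \<eta>(1) by (auto simp: form_core_def)
  obtain M where M: "\<And>x. \<bar>g x\<bar> \<le> M"
    using C0_fun_bounded[of g] g unfolding form_core_def by blast
  have "2 * signed_integral (\<Gamma> g g) \<eta> = E (\<lambda>x. \<eta> x * g x) g + E (\<lambda>x. \<eta> x * g x) g - E (\<lambda>x. g x * g x) \<eta>"
    using energy g \<eta>(1) unfolding energy_measures_def by blast
  moreover have "\<eta> x * g x = g x" for x using one[of x] by (cases "g x = 0") auto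
  moreover have "(\<lambda>x. g x * g x) = (\<lambda>x. (g x)\<^sup>2)" by (simp add: power2_eq_square)
  ultimately have "2 * signed_integral (\<Gamma> g g) \<eta> = 2 * E g g - E (\<lambda>x. (g x)\<^sup>2) \<eta>" by simp
  with E_square_cutoff[OF gF M \<eta>F \<eta>(2,3) one]
  show "E g g / 2 \<le> signed_integral (\<Gamma> g g) \<eta>" "signed_integral (\<Gamma> g g) \<eta> \<le> E g g" by auto
qed

text \<open>
  The constant \<open>2\<close> is sharp: a pure killing form \<open>E f g = \<integral> f g d\<kappa>\<close> has \<open>2 \<Gamma>(g)(X) = E g g\<close>.
\<close>

lemma E_le_energy_mass:
  assumes g: "g \<in> form_core F"
  shows "E g g \<le> 2 * signed_integral (\<Gamma> g g) (\<lambda>x. 1)"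
proof -
  have "compact (closure {x. g x \<noteq> 0})" using g by (simp add: form_core_def C0_fun_def)
  then obtain \<eta> where \<eta>: "\<eta> \<in> form_core F" "\<And>x. 0 \<le> \<eta> x" "\<And>x. \<eta> x \<le> 1"
    and oneK: "\<And>x. x \<in> closure {x. g x \<noteq> 0} \<Longrightarrow> \<eta> x = 1"
    by (rule cutoff_in_core) blast
  have one: "\<eta> x = 1" if "g x \<noteq> 0" for x
    using that closure_subset[of "{x. g x \<noteq> 0}"] by (intro oneK) auto
  obtain M N where MN: "signed_decomposition (\<Gamma> g g) M N"
    "\<And>f. signed_integral (\<Gamma> g g) f = (LINT x|M. f x) - (LINT x|N. f x)"
    "\<And>B. B \<in> sets borel \<Longrightarrow> measure N B \<le> measure M B"
    by (rule energy_measure_decomposition[OF g]) blast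
  have sets: "sets M = sets borel" "sets N = sets borel" and fin: "finite_measure M" "finite_measure N"
    using MN(1) by (auto simp: signed_decomposition_def radon_measure_def)
  interpret M: finite_measure M by fact
  interpret N: finite_measure N by fact
  have \<eta>b: "\<eta> \<in> borel_measurable borel"
    using \<eta>(1) by (simp add: form_core_def C0_fun_def borel_measurable_continuous_onI)
  have "norm (\<eta> x) \<le> 1" for x using \<eta>(2,3)[of x] by simp
  moreover have "\<eta> \<in> borel_measurable M" "\<eta> \<in> borel_measurable N"
    using \<eta>b by (simp_all add: measurable_cong_sets[OF sets(1) refl] measurable_cong_sets[OF sets(2) refl])
  ultimately have int: "integrable M \<eta>" "integrable N \<eta>"
    by (auto intro!: M.integrable_const_bound[of _ 1] N.integrable_const_bound[of _ 1])
  have "(LINT x|N. 1 - \<eta> x) \<le> (LINT x|M. 1 - \<eta> x)"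
    using \<eta> \<eta>b by (intro integral_mono_measure_borel[OF sets(1) fin(1) sets(2) fin(2) MN(3), of _ 1]) auto
  then have "signed_integral (\<Gamma> g g) \<eta> \<le> signed_integral (\<Gamma> g g) (\<lambda>x. 1)"
    unfolding MN(2) using int by simp
  then show ?thesis using signed_integral_cutoff(1)[OF g \<eta> one] by simp
qed

text \<open>
  The constant function \<open>1\<close> need not be in the core. Inner regularity allows a cutoff function
  that is \<open>1\<close> on the support of \<open>g\<close> and on a compact set carrying all but \<open>e\<close> of the mass of the
  positive part.
\<close>

lemma energy_mass_le_E:
  assumes g: "g \<in> form_core F"
  shows "signed_integral (\<Gamma> g g) (\<lambda>x. 1) \<le> E g g"
proof (rule field_le_epsilon)
  fix e :: real assume e: "0 < e"
  obtain M N where MN: "signed_decomposition (\<Gamma> g g) M N"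
    "\<And>f. signed_integral (\<Gamma> g g) f = (LINT x|M. f x) - (LINT x|N. f x)"
    by (rule energy_measure_decomposition[OF g]) blast
  have sets: "sets M = sets borel" "sets N = sets borel" and fin: "finite_measure M" "finite_measure N"
    and inner: "\<And>B. B \<in> sets borel \<Longrightarrow> emeasure M B = (SUP K\<in>{K. compact K \<and> K \<subseteq> B}. emeasure M K)"
    using MN(1) by (auto simp: signed_decomposition_def radon_measure_def)
  interpret M: finite_measure M by fact
  interpret N: finite_measure N by fact
  have space: "space M = UNIV" "space N = UNIV"
    using sets_eq_imp_space_eq[OF sets(1)] sets_eq_imp_space_eq[OF sets(2)] by auto
  obtain K where K: "compact K" "measure M UNIV - e \<le> measure M K"
  proof (cases "measure M UNIV \<le> e")
    case True
    then show ?thesis using that[of "{}"] by simp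
  next
    case False
    then have "ennreal (measure M UNIV - e) < emeasure M UNIV"
      using e by (simp add: M.emeasure_eq_measure ennreal_less_iff)
    then have "ennreal (measure M UNIV - e) < (SUP K\<in>{K. compact K \<and> K \<subseteq> UNIV}. emeasure M K)"
      using inner[of UNIV] by simp
    then obtain K where "compact K" "ennreal (measure M UNIV - e) < emeasure M K"
      unfolding less_SUP_iff by auto
    then show ?thesis using that[of K] False
      by (simp add: M.emeasure_eq_measure ennreal_less_iff)
  qed
  have "compact (K \<union> closure {x. g x \<noteq> 0})" using g K by (auto simp: form_core_def C0_fun_def)
  then obtain \<eta> where \<eta>: "\<eta> \<in> form_core F" "\<And>x. 0 \<le> \<eta> x" "\<And>x. \<eta> x \<le> 1"
    and oneK: "\<And>x. x \<in> K \<union> closure {x. g x \<noteq> 0} \<Longrightarrow> \<eta> x = 1"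
    by (rule cutoff_in_core) blast
  have one: "\<eta> x = 1" if "g x \<noteq> 0" for x
    using that closure_subset[of "{x. g x \<noteq> 0}"] by (intro oneK) auto
  have \<eta>b: "\<eta> \<in> borel_measurable borel"
    using \<eta>(1) by (simp add: form_core_def C0_fun_def borel_measurable_continuous_onI)
  have "norm (\<eta> x) \<le> 1" for x using \<eta>(2,3)[of x] by simp
  moreover have "\<eta> \<in> borel_measurable M" "\<eta> \<in> borel_measurable N"
    using \<eta>b by (simp_all add: measurable_cong_sets[OF sets(1) refl] measurable_cong_sets[OF sets(2) refl])
  ultimately have int: "integrable M \<eta>" "integrable N \<eta>"
    by (auto intro!: M.integrable_const_bound[of _ 1] N.integrable_const_bound[of _ 1])
  have KM: "K \<in> sets M" using K(1) sets(1) by (simp add: borel_compact)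
  have "measure M K = (LINT x|M. indicator K x)" using KM by simp
  also have "\<dots> \<le> (LINT x|M. \<eta> x)"
  proof (intro integral_mono int(1))
    show "integrable M (indicator K :: 'a \<Rightarrow> real)"
      using KM by (simp add: M.emeasure_eq_measure)
    show "indicator K x \<le> \<eta> x" for x using \<eta>(2) oneK by (simp split: split_indicator)
  qed
  finally have 1: "measure M K \<le> (LINT x|M. \<eta> x)" .
  have "(LINT x|N. \<eta> x) \<le> (LINT x|N. 1)" using \<eta>(3) int(2) by (intro integral_mono) auto
  with 1 K(2) have "signed_integral (\<Gamma> g g) (\<lambda>x. 1) - e \<le> signed_integral (\<Gamma> g g) \<eta>"
    unfolding MN(2) by (simp add: space)
  then show "signed_integral (\<Gamma> g g) (\<lambda>x. 1) \<le> E g g + e"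
    using signed_integral_cutoff(2)[OF g \<eta> one] by simp
qed

end

section \<open>From p-th powers to squares on finite measure spaces\<close>

text \<open>
  For nonmeasurable integrands additivity is not available, but the integral is still a supremum
  over simple functions below the integrand, and each of these can be shifted by the constant and
  rescaled. This makes the estimates below applicable to norms of sections, for which
  measurability is only required of inner products.
\<close>

lemma nn_integral_le_const_plus:
  fixes f g :: "'a \<Rightarrow> ennreal"
  assumes C: "0 < C" and le: "\<And>x. x \<in> space M \<Longrightarrow> f x \<le> ennreal c + ennreal C * g x"
  shows "integral\<^sup>N M f \<le> ennreal c * emeasure M (space M) + ennreal C * integral\<^sup>N M g"
  unfolding nn_integral_def[of M f]
proof (rule SUP_least)
  fix s assume "s \<in> {s. simple_function M s \<and> s \<le> f}"
  then have s: "simple_function M s" "s \<le> f" by auto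
  have [measurable]: "s \<in> borel_measurable M" using s(1) by (rule borel_measurable_simple_function)
  define t where "t = (\<lambda>x. (s x - ennreal c) / ennreal C)"
  have t [measurable]: "t \<in> borel_measurable M" unfolding t_def by measurable
  have C': "ennreal C \<noteq> 0" "ennreal C \<noteq> top" using C by auto
  have Ct: "ennreal C * t x = s x - ennreal c" for x
    unfolding t_def ennreal_times_divide 
    by (subst mult.commute) (rule ennreal_mult_divide_eq[OF C'])
  have tg: "t x \<le> g x" if "x \<in> space M" for x
  proof -
    have "s x - ennreal c \<le> ennreal C * g x"
      using le[OF that] s(2) by (metis ennreal_minus_le_iff ennreal_neq_top le_funD order_trans)
    then have "(s x - ennreal c) / ennreal C \<le> ennreal C * g x / ennreal C"
      by (rule divide_right_mono_ennreal)
    then show ?thesis unfolding t_def using C' by (metis ennreal_mult_divide_eq mult.commute)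
  qed
  have "integral\<^sup>S M s = (\<integral>\<^sup>+x. s x \<partial>M)" by (rule nn_integral_eq_simple_integral[OF s(1), symmetric])
  also have "\<dots> \<le> (\<integral>\<^sup>+x. ennreal c + ennreal C * t x \<partial>M)"
    unfolding Ct
  proof (rule nn_integral_mono)
    show "s x \<le> ennreal c + (s x - ennreal c)" for x
      using ennreal_minus_le_iff[of "s x" "ennreal c" "s x - ennreal c"] by simp
  qed
  also have "\<dots> = ennreal c * emeasure M (space M) + ennreal C * integral\<^sup>N M t"
    by (simp add: nn_integral_add nn_integral_cmult)
  also have "\<dots> \<le> ennreal c * emeasure M (space M) + ennreal C * integral\<^sup>N M g"
    by (intro add_left_mono mult_left_mono nn_integral_mono tg) auto
  finally show "integral\<^sup>S M s \<le> ennreal c * emeasure M (space M) + ennreal C * integral\<^sup>N M g" .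
qed


text \<open>
  Pointwise, either \<open>\<bar>a\<bar>\<^sup>2 \<le> d\<close> or \<open>\<bar>a\<bar>\<^sup>2 = \<bar>a\<bar>\<^sup>2\<^sup>-\<^sup>p \<bar>a\<bar>\<^sup>p\<close> with \<open>\<bar>a\<bar>\<^sup>2\<^sup>-\<^sup>p\<close> at most the stated
  constant. The free parameter \<open>d\<close> is later chosen small, which takes the place of the Hoelder
  inequality.
\<close>

lemma Lp_pow_2_le:
  assumes p: "2 < p" and d: "0 < d"
  shows "Lp_pow m 2 g
    \<le> ennreal d * emeasure m (space m) + ennreal (d powr ((2 - p) / 2)) * Lp_pow m p g"
  unfolding Lp_pow_def
proof (rule nn_integral_le_const_plus)
  show "0 < d powr ((2 - p) / 2)" using d by simp
  fix x
  have "norm (g x) powr 2 \<le> d + d powr ((2 - p) / 2) * norm (g x) powr p"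
  proof (cases "norm (g x) powr 2 \<le> d")
    case True
    then show ?thesis by (simp add: add_increasing2)
  next
    case False
    let ?a = "norm (g x)"
    have a: "0 < ?a" using False d by (cases "?a = 0") auto
    have "2 * ((2 - p) / 2) + p = 2" by (simp add: field_simps)
    then have "?a powr 2 = (?a powr 2) powr ((2 - p) / 2) * ?a powr p"
      by (simp only: powr_powr flip: powr_add)
    also have "\<dots> \<le> d powr ((2 - p) / 2) * ?a powr p"
      using False d p by (intro mult_right_mono powr_mono2') auto
    finally show ?thesis using d by simp
  qed
  then show "ennreal (norm (g x) powr 2)
    \<le> ennreal d + ennreal (d powr ((2 - p) / 2)) * ennreal (norm (g x) powr p)"
    using d by (simp add: ennreal_leI flip: ennreal_plus ennreal_mult)
qed

lemma Lp_pow_2_finite: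
  assumes "2 < p" "emeasure m (space m) < \<infinity>" "Lp_pow m p g < \<infinity>"
  shows "Lp_pow m 2 g < \<infinity>"
proof -
  have "ennreal 1 * emeasure m (space m) + ennreal (1 powr ((2 - p) / 2)) * Lp_pow m p g < \<infinity>"
    using assms(2,3) by (auto simp: ennreal_mult_less_top)
  then show ?thesis using Lp_pow_2_le[OF assms(1), of 1 m g] by (rule le_less_trans[rotated]) simp
qed

lemma Lp_pow_2_tendsto_zero:
  assumes p: "2 < p" and fin: "emeasure m (space m) < \<infinity>"
    and lim: "(\<lambda>n. Lp_pow m p (g n)) \<longlonglongrightarrow> 0"
  shows "(\<lambda>n. Lp_pow m 2 (g n)) \<longlonglongrightarrow> 0"
proof (rule order_tendstoI)
  fix a :: ennreal assume "0 < a"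
  then obtain r where r: "0 < r" "ennreal r < a"
    by (metis dense ennreal_cases ennreal_less_zero_iff not_less_zero order_less_imp_not_less top.extremum_strict)
  obtain M where M: "0 \<le> M" "emeasure m (space m) = ennreal M"
    using fin by (cases "emeasure m (space m)") auto
  define d where "d = r / (2 * (M + 1))"
  define C where "C = d powr ((2 - p) / 2)"
  have d: "0 < d" using r M by (simp add: d_def)
  then have C: "0 < C" by (simp add: C_def)
  have dM: "d * M \<le> r / 2" using r M by (simp add: d_def field_simps)
  have "0 < ennreal (r / (2 * C))" using r C by simp
  from order_tendstoD(2)[OF lim this]
  show "\<forall>\<^sub>F n in sequentially. Lp_pow m 2 (g n) < a"
  proof eventually_elim
    case (elim n)
    have "Lp_pow m 2 (g n) \<le> ennreal d * ennreal M + ennreal C * Lp_pow m p (g n)"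
      using Lp_pow_2_le[OF p d] M(2) unfolding C_def by metis
    also have "\<dots> \<le> ennreal d * ennreal M + ennreal C * ennreal (r / (2 * C))"
      using elim by (intro add_left_mono mult_left_mono) auto
    also have "\<dots> = ennreal (d * M + r / 2)"
      using d M C r by (simp flip: ennreal_plus ennreal_mult)
    also have "\<dots> \<le> ennreal r" using dM by (intro ennreal_leI) simp
    finally show ?case using r(2) by simp
  qed
qed simp

section \<open>Closability of the differential\<close>


lemma closure_span_add_scaleR:
  fixes S :: "'b::real_normed_vector set"
  assumes "x \<in> closure (span S)" "y \<in> closure (span S)"
  shows "x + c *\<^sub>R y \<in> closure (span S)"
proof -
  from assms obtain f g where f: "\<And>n. f n \<in> span S" "f \<longlonglongrightarrow> x" and g: "\<And>n. g n \<in> span S" "g \<longlonglongrightarrow> y"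
    unfolding closure_sequential by blast
  have "(\<lambda>n. f n + c *\<^sub>R g n) \<longlonglongrightarrow> x + c *\<^sub>R y" by (intro tendsto_intros f g)
  moreover have "f n + c *\<^sub>R g n \<in> span S" for n by (intro span_add span_scale f g)
  ultimately show ?thesis unfolding closure_sequential by (intro exI[of _ "\<lambda>n. f n + c *\<^sub>R g n"]) simp
qed

theorem theorem6p1:
  fixes \<mu> m :: "'a::{metric_space, second_countable_topology} measure"
    and F :: "('a \<Rightarrow> real) set"
    and E :: "('a \<Rightarrow> real) \<Rightarrow> ('a \<Rightarrow> real) \<Rightarrow> real"
    and \<Gamma> :: "('a \<Rightarrow> real) \<Rightarrow> ('a \<Rightarrow> real) \<Rightarrow> 'a set \<Rightarrow> real"
    and \<tau> :: "('a \<Rightarrow> real) \<Rightarrow> ('a \<Rightarrow> real) \<Rightarrow> 'h::{real_inner, complete_space}"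
    and H :: "'h set"
    and \<phi> :: "nat \<Rightarrow> 'a \<Rightarrow> real"
    and G :: "'a \<Rightarrow> ('a \<Rightarrow> real) \<Rightarrow> ('a \<Rightarrow> real) \<Rightarrow> real"
    and cls :: "'a \<Rightarrow> ('a \<Rightarrow> real) \<Rightarrow> ('a \<Rightarrow> real) \<Rightarrow> 'v::{real_inner, complete_space}"
    and Hx :: "'a \<Rightarrow> 'v set"
    and \<Phi> :: "'h \<Rightarrow> 'a \<Rightarrow> 'v"
    and Cp :: "real \<Rightarrow> ('a \<Rightarrow> real) set"
  assumes "locally compact (UNIV :: 'a set)"
    and "admissible_measure \<mu>"
    and "symmetric_dirichlet_form \<mu> F E" and "regular_form \<mu> F E"
    and "energy_measures F E \<Gamma>"
    and "tensor_completion (form_core F) bounded_borel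
           (\<lambda>a b c d. signed_integral (\<Gamma> a c) (\<lambda>x. b x * d x)) \<tau> H"
    and "admissible_measure m"
    and "\<And>f. f \<in> form_core F \<Longrightarrow> signed_abs_cont m (\<Gamma> f f)"
    and "closable_form_on_L2 m (form_core F) E"
    and "energy_dense_sequence F E \<phi>"
    and "fiber_forms m \<Gamma> \<phi> G"
    and "\<And>x. tensor_completion (seq_span \<phi>) bounded_borel
           (\<lambda>a b c d. b x * d x * G x a c) (cls x) (Hx x)"
    and "direct_integral_iso m \<phi> Hx cls H \<tau> \<Phi>"
    and "\<And>p. 1 < p \<Longrightarrow> fun_subspace (Cp p) \<and> Cp p \<subseteq> form_core F \<inter> Lp_fun m p"
    and "\<And>p. 1 < p \<Longrightarrow> core_I m p (Cp p)"
    and "\<And>p. 1 < p \<Longrightarrow> core_II m p \<phi> Hx cls \<tau> \<Phi> (Cp p)"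
    and "\<And>p. 1 < p \<Longrightarrow> core_III m p \<Gamma> (Cp p)"
    and "emeasure m UNIV < \<infinity>"
  shows "\<forall>p>2. closable_operator m p \<phi> Hx cls (\<lambda>f. \<Phi> (differential \<tau> f)) (Cp p)"
proof (intro allI impI)
  fix p :: real assume p: "2 < p"
  interpret regular_dirichlet_form \<mu> F E \<Gamma>
    using assms(1,3,4,5) by unfold_locales
  have one: "(\<lambda>x. 1) \<in> bounded_borel" by (auto simp: bounded_borel_def)
  have H: "H = closure (span {\<tau> a b | a b. a \<in> form_core F \<and> b \<in> bounded_borel})"
    and \<tau>_add: "\<And>a c. a \<in> form_core F \<Longrightarrow> c \<in> form_core F
        \<Longrightarrow> \<tau> (\<lambda>x. a x + c x) (\<lambda>x. 1) = \<tau> a (\<lambda>x. 1) + \<tau> c (\<lambda>x. 1)"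
    and \<tau>_scale: "\<And>r a. a \<in> form_core F
        \<Longrightarrow> \<tau> (\<lambda>x. r * a x) (\<lambda>x. 1) = r *\<^sub>R \<tau> a (\<lambda>x. 1)"
    and \<tau>_inner: "\<And>a. a \<in> form_core F
        \<Longrightarrow> \<tau> a (\<lambda>x. 1) \<bullet> \<tau> a (\<lambda>x. 1) = signed_integral (\<Gamma> a a) (\<lambda>x. 1 * 1)"
    using assms(6) one unfolding tensor_completion_def by blast+
  have norm_\<tau>: "(norm (\<tau> a (\<lambda>x. 1)))\<^sup>2 = signed_integral (\<Gamma> a a) (\<lambda>x. 1)" if "a \<in> form_core F" for a
    using \<tau>_inner[OF that] by (simp add: power2_norm_eq_inner)
  have \<Phi>_add: "\<And>h k. h \<in> H \<Longrightarrow> k \<in> H \<Longrightarrow> AE x in m. \<Phi> (h + k) x = \<Phi> h x + \<Phi> k x"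
    and \<Phi>_scale: "\<And>c h. h \<in> H \<Longrightarrow> AE x in m. \<Phi> (c *\<^sub>R h) x = c *\<^sub>R \<Phi> h x"
    and \<Phi>_norm: "\<And>h. h \<in> H \<Longrightarrow> Lp_pow m 2 (\<Phi> h) = ennreal ((norm h)\<^sup>2)"
    and \<Phi>_onto: "\<And>\<xi>. \<xi> \<in> Lp_sections m 2 \<phi> Hx cls \<Longrightarrow> \<exists>h\<in>H. AE x in m. \<Phi> h x = \<xi> x"
    using assms(13) unfolding direct_integral_iso_def by blast+
  have "sets m = sets borel"
    using assms(7) by (simp add: admissible_measure_def radon_measure_def)
  then have "space m = UNIV" by (metis sets_eq_imp_space_eq space_borel)
  then have fin: "emeasure m (space m) < \<infinity>" using assms(18) by simp
  have Cp: "fun_subspace (Cp p)" "Cp p \<subseteq> form_core F" using assms(14)[of p] p by auto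
  show "closable_operator m p \<phi> Hx cls (\<lambda>f. \<Phi> (differential \<tau> f)) (Cp p)"
    unfolding closable_operator_def differential_def
  proof (intro allI impI, elim conjE)
    fix u v
    assume u: "\<forall>n. u n \<in> Cp p" and v: "v \<in> Lp_sections m p \<phi> Hx cls"
      and u0: "(\<lambda>n. Lp_pow m p (u n)) \<longlonglongrightarrow> 0"
      and uv: "(\<lambda>n. Lp_pow m p (\<lambda>x. \<Phi> (\<tau> (u n) (\<lambda>x. 1)) x - v x)) \<longlonglongrightarrow> 0"
    define h where "h n = \<tau> (u n) (\<lambda>x. 1)" for n
    have uC: "u n \<in> form_core F" for n using u Cp by blast
    have Cp_add: "(\<lambda>x. f x + g x) \<in> Cp p" if "f \<in> Cp p" "g \<in> Cp p" for f g
      using Cp(1) that unfolding fun_subspace_def by blast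
    have neg: "(\<lambda>x. -1 * u j x) \<in> Cp p" for j
      using Cp(1) u unfolding fun_subspace_def by blast
    have "(\<lambda>x. u i x + (-1 * u j x)) \<in> Cp p" for i j
      by (rule Cp_add[OF u[rule_format] neg])
    then have udC: "(\<lambda>x. u i x - u j x) \<in> form_core F" for i j using Cp(2) by auto
    have hd: "\<tau> (\<lambda>x. u i x - u j x) (\<lambda>x. 1) = h i - h j" for i j
      using \<tau>_add[of "u i" "\<lambda>x. -1 * u j x"] \<tau>_scale[of "u j" "-1"] uC neg[of j] Cp(2)
      by (auto simp: h_def)
    have hH: "h n \<in> H" for n
      unfolding H h_def using uC[of n] one
      by (intro subsetD[OF closure_subset] span_base) blast
    have "v \<in> Lp_sections m 2 \<phi> Hx cls"
      using v Lp_pow_2_finite[OF p fin, of v] by (simp add: Lp_sections_def)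
    then obtain k where k: "k \<in> H" "AE x in m. \<Phi> k x = v x" using \<Phi>_onto by blast
    \<comment> \<open>Expressed through \<open>k\<close>, the \<open>L\<^sub>2\<close>-distance to \<open>v\<close> is a norm in \<open>H\<close>; this avoids triangle inequalities
      for integrals of norms of sections, whose measurability is not part of the definition.\<close>
    have "Lp_pow m 2 (\<lambda>x. \<Phi> (h n) x - v x) = ennreal ((norm (h n - k))\<^sup>2)" for n
    proof -
      have kk: "(-1) *\<^sub>R k \<in> H" and dH: "h n + (-1) *\<^sub>R k \<in> H"
        using k(1) hH[of n] closure_span_add_scaleR[of k _ k "-2"] closure_span_add_scaleR[of "h n" _ k "-1"]
        unfolding H by (auto simp: scaleR_2)
      have "AE x in m. \<Phi> (h n) x - v x = \<Phi> (h n + (-1) *\<^sub>R k) x"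
        using k(2) \<Phi>_add[OF hH[of n] kk] \<Phi>_scale[OF k(1), of "-1"] by eventually_elim simp
      then have "Lp_pow m 2 (\<lambda>x. \<Phi> (h n) x - v x) = Lp_pow m 2 (\<Phi> (h n + (-1) *\<^sub>R k))"
        unfolding Lp_pow_def by (intro nn_integral_cong_AE) (auto elim: eventually_mono)
      then show ?thesis using \<Phi>_norm[OF dH] by simp
    qed
    then have "(\<lambda>n. ennreal ((norm (h n - k))\<^sup>2)) \<longlonglongrightarrow> ennreal 0"
      using Lp_pow_2_tendsto_zero[OF p fin uv] by (simp add: h_def)
    then have "(\<lambda>n. (norm (h n - k))\<^sup>2) \<longlonglongrightarrow> 0" by (rule tendsto_ennrealD) auto
    from tendsto_real_sqrt[OF this] have "(\<lambda>n. norm (h n - k)) \<longlonglongrightarrow> 0" by simp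
    then have hk: "h \<longlonglongrightarrow> k" by (simp add: tendsto_norm_zero_iff LIM_zero_iff)
    have "\<exists>N. \<forall>i\<ge>N. \<forall>j\<ge>N. E (\<lambda>x. u i x - u j x) (\<lambda>x. u i x - u j x) < e" if e: "0 < e" for e
    proof -
      have "0 < sqrt (e / 2)" using e by simp
      then obtain N where N: "\<And>i j. i \<ge> N \<Longrightarrow> j \<ge> N \<Longrightarrow> norm (h i - h j) < sqrt (e / 2)"
        using CauchyD[OF LIMSEQ_imp_Cauchy[OF hk]] by blast
      have "E (\<lambda>x. u i x - u j x) (\<lambda>x. u i x - u j x) < e" if "i \<ge> N" "j \<ge> N" for i j
      proof -
        have "(norm (h i - h j))\<^sup>2 < (sqrt (e / 2))\<^sup>2"
          using N[OF that] by (intro power_strict_mono) auto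
        then show ?thesis
          using E_le_energy_mass[OF udC[of i j]] norm_\<tau>[OF udC[of i j]] e unfolding hd by simp
      qed
      then show ?thesis by blast
    qed
    then have E0: "(\<lambda>n. E (u n) (u n)) \<longlonglongrightarrow> 0"
      using assms(9) uC Lp_pow_2_tendsto_zero[OF p fin u0]
      unfolding closable_form_on_L2_def by blast
    have "(\<lambda>n. (norm (h n))\<^sup>2) \<longlonglongrightarrow> 0"
    proof (rule tendsto_sandwich[OF _ _ tendsto_const E0])
      show "\<forall>\<^sub>F n in sequentially. (norm (h n))\<^sup>2 \<le> E (u n) (u n)"
        using energy_mass_le_E[OF uC] norm_\<tau>[OF uC] by (simp add: h_def)
    qed simp
    from tendsto_real_sqrt[OF this] have "h \<longlonglongrightarrow> 0" by (simp add: tendsto_norm_zero_iff)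
    with hk have "k = 0" by (rule LIMSEQ_unique)
    \<comment> \<open>The equation \<open>\<Phi> 0 = 0\<close> (a.e.) comes from homogeneity: \<open>\<Phi> (0 *\<^sub>R 0) = 0 *\<^sub>R \<Phi> 0\<close>.\<close>
    then show "AE x in m. v x = 0"
      using k \<Phi>_scale[of 0 0] by (auto elim: eventually_elim2)
  qed
qed

end
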